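(* Let $\boldsymbol{\lambda}=\{\lambda_n\}_{n\in\mathbb{N}}$ be a sequence of complex numbers and let $h_{\boldsymbol{\lambda}}(z)=\sum_{n=0}^\infty\lambda_nz^n$. Let $(X_n)_{n\in\mathbb{N}}$ be a sequence of independent identically distributed real random variables on a probability space $(\Omega,\mathcal{A},\mathbb{P})$ such that $\mathbb{E}[X_n]=0$ and $\mathbb{E}[X_n^4]$ is finite. If $h_{\boldsymbol{\lambda}}\in\mathcal{D}$, then almost surely the Hankel type operator $\mathcal{H}_{\boldsymbol{\omega}}$ is compact on the Dirichlet space $\mathcal{D}$, where $\boldsymbol{\omega}=\{X_n\overline{\lambda_n}\}_{n\in\mathbb{N}}$.
   Context: $\mathbb{N}$ is the set of nonnegative integers, $\mathbb{D}$ is the open unit disk, $H(\mathbb{D})$ is the space of analytic functions on $\mathbb{D}$, and $dA=\pi^{-1}dx\,dy$ is normalized Lebesgue measure on $\mathbb{D}$. The Dirichlet space $\mathcal{D}$ is the Hilbert space of $f\in H(\mathbb{D})$ with $\|f\|_{\mathcal{D}}^2=|f(0)|^2+\int_{\mathbb{D}}|f'(z)|^2dA(z)<\infty$. For a sequence $\boldsymbol{\omega}=\{\omega_n\}_{n\in\mathbb{N}}$ of complex numbers and $f(z)=\sum_{k\ge0}a_kz^k\in H(\mathbb{D})$, the Hankel type operator is $\mathcal{H}_{\boldsymbol{\omega}}(f)(z)=\sum_{n=0}^\infty\left(\sum_{k=0}^\infty\omega_{n+k}a_k\right)z^n$, whenever the right-hand side makes sense and defines an analytic function in $\mathbb{D}$.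 It is compact on $\mathcal{D}$ if $\mathcal{H}_{\boldsymbol{\omega}}(f)$ is well defined for every $f\in\mathcal{D}$ and $\mathcal{H}_{\boldsymbol{\omega}}$ is a compact linear operator from $\mathcal{D}$ to $\mathcal{D}$. *)

theory Defs
  imports "HOL-Probability.Probability" "HOL-Complex_Analysis.Complex_Analysis"
begin

abbreviation unit_disk :: "complex set" ("\<bbbD>")
  where "\<bbbD> \<equiv> ball 0 1"

text \<open>
  A function on the open unit disk is represented by the total function that vanishes outside the
  disk, so that equality of functions on the disk is equality in HOL and the vector space
  operations are the pointwise ones.
\<close>

definition dirichlet_space :: "(complex \<Rightarrow> complex) set" where
  "dirichlet_space = {f. f holomorphic_on \<bbbD> \<and> (\<forall>z. z \<notin> \<bbbD> \<longrightarrow> f z = 0) \<and>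
     set_integrable lborel \<bbbD> (\<lambda>z. (cmod (deriv f z))\<^sup>2)}"

definition dirichlet_norm :: "(complex \<Rightarrow> complex) \<Rightarrow> real" where
  "dirichlet_norm f =
     sqrt ((cmod (f 0))\<^sup>2 + (LINT z:\<bbbD>|lborel. (cmod (deriv f z))\<^sup>2) / pi)"

text \<open>
  The locale \<open>Metric_space\<close> demands symmetry of the distance function also outside the carrier,
  hence the default value.
\<close>

definition dirichlet_dist :: "(complex \<Rightarrow> complex) \<Rightarrow> (complex \<Rightarrow> complex) \<Rightarrow> real" where
  "dirichlet_dist f g =
     (if f \<in> dirichlet_space \<and> g \<in> dirichlet_space then dirichlet_norm (\<lambda>z. f z - g z) else 0)"

lemma dirichlet_space_holo: "f \<in> dirichlet_space \<Longrightarrow> f holomorphic_on \<bbbD>"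
  and dirichlet_space_outside: "f \<in> dirichlet_space \<Longrightarrow> z \<notin> \<bbbD> \<Longrightarrow> f z = 0"
  and dirichlet_space_integrable:
    "f \<in> dirichlet_space \<Longrightarrow> set_integrable lborel \<bbbD> (\<lambda>z. (cmod (deriv f z))\<^sup>2)"
  by (auto simp: dirichlet_space_def)

lemma deriv_sq_set_measurable:
  assumes "f holomorphic_on \<bbbD>"
  shows "set_borel_measurable lborel \<bbbD> (\<lambda>z. (cmod (deriv f z))\<^sup>2)"
proof -
  have "continuous_on \<bbbD> (\<lambda>z. (cmod (deriv f z))\<^sup>2)"
    by (intro continuous_intros holomorphic_on_imp_continuous_on holomorphic_deriv assms) auto
  then have "set_borel_measurable borel \<bbbD> (\<lambda>z. (cmod (deriv f z))\<^sup>2)"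
    unfolding set_borel_measurable_def
    by (intro borel_measurable_continuous_on_indicator) auto
  then show ?thesis by (simp add: set_borel_measurable_def)
qed

lemma dirichlet_space_cmult:
  assumes f: "f \<in> dirichlet_space"
  shows "(\<lambda>z. c * f z) \<in> dirichlet_space"
    and "dirichlet_norm (\<lambda>z. c * f z) = cmod c * dirichlet_norm f"
proof -
  have d: "deriv (\<lambda>z. c * f z) z = c * deriv f z" if "z \<in> \<bbbD>" for z
    using dirichlet_space_holo[OF f] that
    by (intro deriv_cmult holomorphic_on_imp_differentiable_at[of _ \<bbbD>]) auto
  then have e: "(cmod (deriv (\<lambda>z. c * f z) z))\<^sup>2 = (cmod c)\<^sup>2 * (cmod (deriv f z))\<^sup>2" if "z \<in> \<bbbD>" for z
    using that by (simp add: norm_mult power_mult_distrib)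
  have "set_integrable lborel \<bbbD> (\<lambda>z. (cmod c)\<^sup>2 * (cmod (deriv f z))\<^sup>2)"
    using dirichlet_space_integrable[OF f] by (intro set_integrable_mult_right) auto
  then have "set_integrable lborel \<bbbD> (\<lambda>z. (cmod (deriv (\<lambda>z. c * f z) z))\<^sup>2)"
    by (rule set_integrable_cong[THEN iffD1, rotated -1]) (use e in auto)
  then show "(\<lambda>z. c * f z) \<in> dirichlet_space"
    using f by (auto simp: dirichlet_space_def intro!: holomorphic_intros)
  have "(LINT z:\<bbbD>|lborel. (cmod (deriv (\<lambda>z. c * f z) z))\<^sup>2)
      = (LINT z:\<bbbD>|lborel. (cmod c)\<^sup>2 * (cmod (deriv f z))\<^sup>2)"
    by (rule set_lebesgue_integral_cong) (use e in auto)
  then have "(cmod (c * f 0))\<^sup>2 + (LINT z:\<bbbD>|lborel. (cmod (deriv (\<lambda>z. c * f z) z))\<^sup>2) / pi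
     = (cmod c)\<^sup>2 * ((cmod (f 0))\<^sup>2 + (LINT z:\<bbbD>|lborel. (cmod (deriv f z))\<^sup>2) / pi)"
    by (simp add: norm_mult power_mult_distrib algebra_simps)
  then show "dirichlet_norm (\<lambda>z. c * f z) = cmod c * dirichlet_norm f"
    by (simp add: dirichlet_norm_def real_sqrt_mult)
qed

lemma dirichlet_integral_nonneg: "0 \<le> (LINT z:\<bbbD>|lborel. (cmod (deriv f z))\<^sup>2)"
  unfolding set_lebesgue_integral_def by (intro integral_nonneg_AE) auto

lemma dirichlet_norm_nonneg [simp]: "0 \<le> dirichlet_norm f"
  by (simp add: dirichlet_norm_def dirichlet_integral_nonneg)

lemma dirichlet_norm_power2:
  "(dirichlet_norm f)\<^sup>2 = (cmod (f 0))\<^sup>2 + (LINT z:\<bbbD>|lborel. (cmod (deriv f z))\<^sup>2) / pi"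
  by (simp add: dirichlet_norm_def dirichlet_integral_nonneg)

lemma norm_add_sq_le:
  fixes a b :: complex
  assumes "t > 0"
  shows "(cmod (a + b))\<^sup>2 \<le> (1 + t) * (cmod a)\<^sup>2 + (1 + 1 / t) * (cmod b)\<^sup>2"
proof -
  have "(cmod (a + b))\<^sup>2 \<le> (cmod a + cmod b)\<^sup>2"
    by (intro power_mono norm_triangle_ineq) auto
  also have "\<dots> \<le> (1 + t) * (cmod a)\<^sup>2 + (1 + 1 / t) * (cmod b)\<^sup>2"
  proof -
    have "0 \<le> (t * cmod a - cmod b)\<^sup>2 / t" using assms by simp
    also have "\<dots> = t * (cmod a)\<^sup>2 + (1 / t) * (cmod b)\<^sup>2 - 2 * cmod a * cmod b"
      using assms by (simp add: field_simps power2_eq_square)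
    finally show ?thesis by (simp add: power2_sum algebra_simps)
  qed
  finally show ?thesis .
qed

lemma dirichlet_space_add_aux:
  assumes f: "f \<in> dirichlet_space" and g: "g \<in> dirichlet_space"
  shows "(\<lambda>z. f z + g z) \<in> dirichlet_space"
    and "t > 0 \<Longrightarrow> (dirichlet_norm (\<lambda>z. f z + g z))\<^sup>2
      \<le> (1 + t) * (dirichlet_norm f)\<^sup>2 + (1 + 1 / t) * (dirichlet_norm g)\<^sup>2"
proof -
  have hol: "(\<lambda>z. f z + g z) holomorphic_on \<bbbD>"
    using f g by (intro holomorphic_intros dirichlet_space_holo)
  have d: "deriv (\<lambda>z. f z + g z) z = deriv f z + deriv g z" if "z \<in> \<bbbD>" for z
    using dirichlet_space_holo[OF f] dirichlet_space_holo[OF g] that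
    by (intro deriv_add holomorphic_on_imp_differentiable_at[of _ \<bbbD>]) auto
  have e: "(cmod (deriv (\<lambda>z. f z + g z) z))\<^sup>2
      \<le> (1 + t) * (cmod (deriv f z))\<^sup>2 + (1 + 1 / t) * (cmod (deriv g z))\<^sup>2"
    if "z \<in> \<bbbD>" "t > 0" for z t
    using norm_add_sq_le[OF that(2)] d[OF that(1)] by simp
  have i: "set_integrable lborel \<bbbD>
      (\<lambda>z. (1 + t) * (cmod (deriv f z))\<^sup>2 + (1 + 1 / t) * (cmod (deriv g z))\<^sup>2)" for t :: real
    using dirichlet_space_integrable[OF f] dirichlet_space_integrable[OF g]
    by (intro set_integral_add set_integrable_mult_right) auto
  have j: "set_integrable lborel \<bbbD> (\<lambda>z. (cmod (deriv (\<lambda>z. f z + g z) z))\<^sup>2)"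
    by (rule set_integrable_bound[OF i[of 1] deriv_sq_set_measurable[OF hol]])
       (use e[of _ 1] in auto)
  then show "(\<lambda>z. f z + g z) \<in> dirichlet_space"
    using f g hol by (auto simp: dirichlet_space_def)
  assume t: "t > 0"
  have "(LINT z:\<bbbD>|lborel. (cmod (deriv (\<lambda>z. f z + g z) z))\<^sup>2)
     \<le> (LINT z:\<bbbD>|lborel. (1 + t) * (cmod (deriv f z))\<^sup>2 + (1 + 1 / t) * (cmod (deriv g z))\<^sup>2)"
    by (rule set_integral_mono[OF j i]) (use e t in auto)
  also have "\<dots> = (1 + t) * (LINT z:\<bbbD>|lborel. (cmod (deriv f z))\<^sup>2)
      + (1 + 1 / t) * (LINT z:\<bbbD>|lborel. (cmod (deriv g z))\<^sup>2)"
    using dirichlet_space_integrable[OF f] dirichlet_space_integrable[OF g]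
    by (subst set_integral_add(2)) (auto intro!: set_integrable_mult_right)
  finally have "(LINT z:\<bbbD>|lborel. (cmod (deriv (\<lambda>z. f z + g z) z))\<^sup>2) / pi
     \<le> ((1 + t) * (LINT z:\<bbbD>|lborel. (cmod (deriv f z))\<^sup>2)
      + (1 + 1 / t) * (LINT z:\<bbbD>|lborel. (cmod (deriv g z))\<^sup>2)) / pi"
    by (intro divide_right_mono) auto
  then show "(dirichlet_norm (\<lambda>z. f z + g z))\<^sup>2
      \<le> (1 + t) * (dirichlet_norm f)\<^sup>2 + (1 + 1 / t) * (dirichlet_norm g)\<^sup>2"
    using norm_add_sq_le[OF t, of "f 0" "g 0"]
    unfolding dirichlet_norm_power2 by (simp add: add_divide_distrib ring_distribs)
qed

lemmas dirichlet_space_add = dirichlet_space_add_aux(1)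

lemma dirichlet_space_zero: "(\<lambda>_. 0) \<in> dirichlet_space"
  by (simp add: dirichlet_space_def set_integrable_def)

lemma dirichlet_space_diff:
  assumes "f \<in> dirichlet_space" "g \<in> dirichlet_space"
  shows "(\<lambda>z. f z - g z) \<in> dirichlet_space"
  using dirichlet_space_add[OF assms(1) dirichlet_space_cmult(1)[OF assms(2), of "-1"]] by simp

lemma dirichlet_norm_eq_0:
  assumes f: "f \<in> dirichlet_space"
  shows "dirichlet_norm f = 0 \<longleftrightarrow> f = (\<lambda>_. 0)"
proof
  assume "f = (\<lambda>_. 0)" then show "dirichlet_norm f = 0" 
    by (simp add: dirichlet_norm_def set_lebesgue_integral_def)
next
  assume "dirichlet_norm f = 0"
  then have "(cmod (f 0))\<^sup>2 + (LINT z:\<bbbD>|lborel. (cmod (deriv f z))\<^sup>2) / pi = 0"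
    using dirichlet_norm_power2[of f] by simp
  then have f0: "f 0 = 0" and I: "(LINT z:\<bbbD>|lborel. (cmod (deriv f z))\<^sup>2) = 0"
    using dirichlet_integral_nonneg[of f] by (auto simp: add_nonneg_eq_0_iff)
  have "AE z in lborel. indicator \<bbbD> z *\<^sub>R (cmod (deriv f z))\<^sup>2 = 0"
    using I dirichlet_space_integrable[OF f] unfolding set_lebesgue_integral_def set_integrable_def
    by (subst (asm) integral_nonneg_eq_0_iff_AE) auto
  then have ae: "AE z in lebesgue. z \<notin> {z\<in>\<bbbD>. deriv f z \<noteq> 0}"
    by (intro AE_completion) (auto elim!: eventually_mono split: split_indicator_asm)
  have "open {z\<in>\<bbbD>. deriv f z \<noteq> 0}"
  proof -
    have "continuous_on \<bbbD> (deriv f)"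
      by (intro holomorphic_on_imp_continuous_on holomorphic_deriv dirichlet_space_holo f) auto
    then have "open (\<bbbD> \<inter> deriv f -` (- {0}))"
      by (rule continuous_open_preimage) auto
    then show ?thesis by (simp add: Int_def vimage_def)
  qed
  moreover have "negligible {z\<in>\<bbbD>. deriv f z \<noteq> 0}"
  proof -
    have "{z\<in>\<bbbD>. deriv f z \<noteq> 0} \<in> sets lebesgue" using calculation by (simp add: lborelD)
    then show ?thesis using ae by (simp add: negligible_iff_null_sets AE_iff_null_sets)
  qed
  ultimately have "{z\<in>\<bbbD>. deriv f z \<noteq> 0} = {}"
    using open_not_negligible by blast
  then have d0: "deriv f z = 0" if "z \<in> \<bbbD>" for z using that by blast
  have "f z = f 0" if z: "z \<in> \<bbbD>" for z
  proof -
    have "(f has_field_derivative 0) (at z within \<bbbD>)" if "z \<in> \<bbbD>" for z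
      using holomorphic_derivI[OF dirichlet_space_holo[OF f] _ that] d0[OF that]
      by (simp add: has_field_derivative_at_within)
    from has_field_derivative_zero_constant[OF convex_ball this] 
    obtain c where "\<And>x. x \<in> \<bbbD> \<Longrightarrow> f x = c" by blast
    with z show ?thesis by simp
  qed
  then have "f z = 0" for z
    using f0 dirichlet_space_outside[OF f] by (cases "z \<in> \<bbbD>") metis+
  then show "f = (\<lambda>_. 0)" by (rule ext)
qed

lemma dirichlet_norm_triangle:
  assumes f: "f \<in> dirichlet_space" and g: "g \<in> dirichlet_space"
  shows "dirichlet_norm (\<lambda>z. f z + g z) \<le> dirichlet_norm f + dirichlet_norm g"
proof (cases "dirichlet_norm f = 0 \<or> dirichlet_norm g = 0")
  case True
  then have "f = (\<lambda>_. 0) \<or> g = (\<lambda>_. 0)" using dirichlet_norm_eq_0 f g by blast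
  then show ?thesis by auto
next
  case False
  let ?p = "dirichlet_norm f" and ?q = "dirichlet_norm g"
  have pq: "?p > 0" "?q > 0"
    using False dirichlet_norm_nonneg[of f] dirichlet_norm_nonneg[of g] by linarith+
  have "(dirichlet_norm (\<lambda>z. f z + g z))\<^sup>2 \<le> (1 + ?q / ?p) * ?p\<^sup>2 + (1 + 1 / (?q / ?p)) * ?q\<^sup>2"
    using pq by (intro dirichlet_space_add_aux(2) f g) auto
  also have "\<dots> = (?p + ?q)\<^sup>2"
    using pq by (simp add: field_simps power2_eq_square)
  finally show ?thesis by (rule power2_le_imp_le) simp
qed

global_interpretation dirichlet: Metric_space dirichlet_space dirichlet_dist
proof
  fix f g h
  show "0 \<le> dirichlet_dist f g" by (simp add: dirichlet_dist_def)
  show "dirichlet_dist f g = dirichlet_dist g f"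
    using dirichlet_space_cmult(2)[OF dirichlet_space_diff[of f g], of "-1"]
    by (auto simp: dirichlet_dist_def)
  assume f: "f \<in> dirichlet_space" and g: "g \<in> dirichlet_space"
  show "dirichlet_dist f g = 0 \<longleftrightarrow> f = g"
    using dirichlet_norm_eq_0[OF dirichlet_space_diff[OF f g]] f g
    by (auto simp: dirichlet_dist_def fun_eq_iff)
  assume h: "h \<in> dirichlet_space"
  show "dirichlet_dist f h \<le> dirichlet_dist f g + dirichlet_dist g h"
    using dirichlet_norm_triangle[OF dirichlet_space_diff[OF f g] dirichlet_space_diff[OF g h]]
      f g h by (simp add: dirichlet_dist_def)
qed

definition power_series_fun :: "(nat \<Rightarrow> complex) \<Rightarrow> complex \<Rightarrow> complex" where
  "power_series_fun c z = (if z \<in> \<bbbD> then \<Sum>n. c n * z ^ n else 0)"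

definition converges_on_disk :: "(nat \<Rightarrow> complex) \<Rightarrow> bool" where
  "converges_on_disk c \<longleftrightarrow> (\<forall>z\<in>\<bbbD>. summable (\<lambda>n. c n * z ^ n))"

definition taylor_coeff :: "(complex \<Rightarrow> complex) \<Rightarrow> nat \<Rightarrow> complex" where
  "taylor_coeff f k = (deriv ^^ k) f 0 / fact k"

definition hankel_coeff :: "(nat \<Rightarrow> complex) \<Rightarrow> (complex \<Rightarrow> complex) \<Rightarrow> nat \<Rightarrow> complex" where
  "hankel_coeff \<omega> f n = (\<Sum>k. \<omega> (n + k) * taylor_coeff f k)"

definition hankel_operator :: "(nat \<Rightarrow> complex) \<Rightarrow> (complex \<Rightarrow> complex) \<Rightarrow> complex \<Rightarrow> complex" where
  "hankel_operator \<omega> f = power_series_fun (hankel_coeff \<omega> f)"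

text \<open>
  A power series that converges at every point of the disk has an analytic sum there, so
  analyticity of \<open>hankel_operator \<omega> f\<close> is not a separate requirement.
\<close>

definition hankel_well_defined :: "(nat \<Rightarrow> complex) \<Rightarrow> (complex \<Rightarrow> complex) \<Rightarrow> bool" where
  "hankel_well_defined \<omega> f \<longleftrightarrow>
     (\<forall>n. summable (\<lambda>k. \<omega> (n + k) * taylor_coeff f k)) \<and>
     converges_on_disk (hankel_coeff \<omega> f)"

definition dirichlet_compact_operator ::
    "((complex \<Rightarrow> complex) \<Rightarrow> complex \<Rightarrow> complex) \<Rightarrow> bool" where
  "dirichlet_compact_operator T \<longleftrightarrow>
     T \<in> dirichlet_space \<rightarrow> dirichlet_space \<and>
     (\<forall>f\<in>dirichlet_space. \<forall>g\<in>dirichlet_space. T (\<lambda>z. f z + g z) = (\<lambda>z. T f z + T g z)) \<and>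
     (\<forall>c. \<forall>f\<in>dirichlet_space. T (\<lambda>z. c * f z) = (\<lambda>z. c * T f z)) \<and>
     compactin dirichlet.mtopology
       (dirichlet.mtopology closure_of (T ` {f \<in> dirichlet_space. dirichlet_norm f \<le> 1}))"

definition hankel_compact_on_dirichlet :: "(nat \<Rightarrow> complex) \<Rightarrow> bool" where
  "hankel_compact_on_dirichlet \<omega> \<longleftrightarrow>
     (\<forall>f\<in>dirichlet_space. hankel_well_defined \<omega> f) \<and>
     dirichlet_compact_operator (hankel_operator \<omega>)"

end

theory Submission
  imports Defs
begin

text \<open>
  In the basis \<open>z ^ k / sqrt (k + 1)\<close> the Hankel operator has the matrix
  \<open>A n k = sqrt (n + 1) / sqrt (k + 1) * \<omega> (n + k)\<close>. This matrix need not be Hilbert-Schmidt, but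
  almost surely \<open>A\<^sup>* A\<close> is, and this suffices for compactness. Put \<open>c m = (m + 1) * |\<lambda> m|\<^sup>2\<close>, which is
  summable because \<open>h \<in> \<D>\<close>. The diagonal entries of \<open>A\<^sup>* A\<close> are at most \<open>S / (k + 1)\<close> with
  \<open>S = (\<Sum>m. (m + 1) * |\<omega> m|\<^sup>2)\<close>, which is finite almost surely. For \<open>k \<noteq> l\<close> the products
  \<open>X (n + k) * X (n + l)\<close> with different \<open>n\<close> are orthogonal, so the \<open>(k, l)\<close> entry has second moment at
  most \<open>E X\<^sup>4 * (\<Sum>n. c (n + k) * c (n + l)) / ((k + 1) * (l + 1))\<close>; by
  \<open>2 / ((k + 1) * (l + 1)) \<le> 1 / (k + 1)\<^sup>2 + 1 / (l + 1)\<^sup>2\<close> the sum of these over all \<open>k\<close> and \<open>l\<close> is at most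
  \<open>E X\<^sup>4 * (\<Sum>m. c m)\<^sup>2 * \<pi>\<^sup>2 / 6\<close>.
\<close>

text \<open>The obstacle is a logarithm. Summing \<open>(n + 1) / (k + 1)\<close> over
  \<open>n + k = m\<close> gives order \<open>m * log m\<close>, so the Hilbert-Schmidt norm of
  \<open>A\<close> would need a weight \<open>m * log m\<close> on the squared symbol, while
  \<open>h \<in> \<D>\<close> supplies only the weight \<open>m + 1\<close>. In the Gram matrix the
  same loss sits in the trace, where the bound \<open>S / (k + 1)\<close> is not summable; the
  Hilbert-Schmidt norm squares these entries and the loss disappears. Off the diagonal nothing is
  gained by absolute values: there the cancellation comes from independence and mean zero, and since
  the entries are quadratic in \<open>X\<close>, their second moments are of degree four in
  \<open>X\<close>. Compactness passes from the Gram matrix to \<open>A\<close> through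
  \<open>|A a|^2 = <A* A a, a> \<le> |A* A| * |a|^2\<close> with the Hilbert-Schmidt norm on the
  right. For \<open>a\<close> supported on indices from \<open>M\<close> on, only the block of the
  Gram matrix with both indices at least \<open>M\<close> enters, and its norm tends to 0 as
  \<open>M\<close> grows; finitely many leading coefficients are handled by coefficientwise
  convergence.\<close>

section \<open>Area integrals of power series\<close>

text \<open>
  The library states the invariance of Lebesgue measure under orthogonal maps only for
  \<open>real ^ 'n\<close>, hence the detour through \<open>real ^ 2\<close>.
\<close>

definition vec2 :: "complex \<Rightarrow> real ^ 2" where "vec2 z = vector [Re z, Im z]"

definition cplx2 :: "real ^ 2 \<Rightarrow> complex" where "cplx2 v = Complex (v $ 1) (v $ 2)"

lemma vec2_cplx2 [simp]: "vec2 (cplx2 v) = v"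
  by (simp add: vec2_def cplx2_def vec_eq_iff forall_2)

lemma cplx2_vec2 [simp]: "cplx2 (vec2 z) = z"
  by (simp add: vec2_def cplx2_def complex_eq_iff)

lemma linear_vec2: "linear vec2"
  by (rule linearI) (simp_all add: vec2_def vec_eq_iff forall_2)

lemma linear_cplx2: "linear cplx2"
  by (rule linearI) (simp_all add: cplx2_def complex_eq_iff)

lemma norm_vec2: "norm (vec2 z) = norm z"
  by (simp add: vec2_def norm_vec_def L2_set_def sum_2 cmod_def)

lemma norm_cplx2: "norm (cplx2 z) = norm z"
  by (metis norm_vec2 vec2_cplx2)

lemma Basis_vec2: "(Basis :: (real^2) set) = {axis 1 1, axis 2 1}"
  by (auto simp: Basis_vec_def UNIV_2)

text \<open>Lebesgue measure is determined by its values on boxes, and \<open>cplx2\<close> pulls a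
  box back to a box with the same side lengths.\<close>

lemma distr_cplx2: "distr lborel borel cplx2 = lborel"
proof (rule lborel_eqI[symmetric])
  have m[measurable]: "cplx2 \<in> borel_measurable borel"
    by (intro borel_measurable_continuous_onI linear_continuous_on)
       (simp add: linear_cplx2 linear_conv_bounded_linear[symmetric])
  fix l u :: complex assume le: "\<And>b. b \<in> Basis \<Longrightarrow> l \<bullet> b \<le> u \<bullet> b"
  have "cplx2 -` box l u = box (vec2 l) (vec2 u)"
    by (auto simp: box_def Basis_vec2 Basis_complex_def cplx2_def vec2_def inner_axis inner_complex_def)
  then have "emeasure (distr lborel borel cplx2) (box l u) = emeasure lborel (box (vec2 l) (vec2 u))"
    by (subst emeasure_distr) auto
  also have "\<dots> = (\<Prod>b\<in>Basis. (vec2 u - vec2 l) \<bullet> b)"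
    using le[of 1] le[of \<i>]
    by (intro emeasure_lborel_box) (auto simp: Basis_vec2 Basis_complex_def vec2_def inner_axis)
  also have "\<dots> = (\<Prod>b\<in>Basis. (u - l) \<bullet> b)"
    by (simp add: Basis_vec2 Basis_complex_def vec2_def inner_axis axis_eq_axis inner_diff_left)
  finally show "emeasure (distr lborel borel cplx2) (box l u) = (\<Prod>b\<in>Basis. (u - l) \<bullet> b)" .
qed simp

text \<open>The preimage of a box under multiplication by \<open>c\<close>, read in
  \<open>real ^ 2\<close>, is the image of a box under \<open>R\<close>, which is multiplication by
  \<open>inverse c\<close>. This map is linear and preserves norms, so it is orthogonal and keeps
  the measure of the box.\<close>

lemma distr_lborel_rotation:
  fixes c :: complex
  assumes c: "cmod c = 1"
  shows "distr lborel borel ((*) c) = lborel"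
proof (rule lborel_eqI[symmetric])
  have c0: "c \<noteq> 0" using c by auto
  have m[measurable]: "cplx2 \<in> borel_measurable borel"
    by (intro borel_measurable_continuous_onI linear_continuous_on)
       (simp add: linear_cplx2 linear_conv_bounded_linear[symmetric])
  fix l u :: complex assume le: "\<And>b. b \<in> Basis \<Longrightarrow> l \<bullet> b \<le> u \<bullet> b"
  define R where "R v = vec2 (inverse c * cplx2 v)" for v
  have "linear R"
    unfolding R_def using linear_cplx2 linear_vec2
    by (intro linear_compose[of "\<lambda>v. inverse c * cplx2 v" vec2, unfolded o_def]
        linear_compose[of cplx2 "(*) (inverse c)", unfolded o_def])
       (auto intro: bounded_linear.linear bounded_linear_mult_right)
  then have R: "orthogonal_transformation R"
    by (simp add: orthogonal_transformation R_def norm_vec2 norm_cplx2 norm_mult norm_inverse c)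
  define B where "B = cplx2 -` box l u"
  have B: "B = box (vec2 l) (vec2 u)"
    by (auto simp: B_def box_def Basis_vec2 Basis_complex_def cplx2_def vec2_def inner_axis inner_complex_def)
  have im: "cplx2 -` ((*) c -` box l u) = R ` B"
  proof -
    have "v \<in> R ` B" if "c * cplx2 v \<in> box l u" for v
      using that c0 by (intro image_eqI[of _ _ "vec2 (c * cplx2 v)"]) (auto simp: B_def R_def mult.assoc[symmetric])
    then show ?thesis using c0 by (auto simp: R_def B_def mult.assoc[symmetric])
  qed
  have RB: "R ` B \<in> sets borel"
    unfolding im[symmetric] using measurable_sets[OF m, of "(*) c -` box l u"] 
    by (auto simp: vimage_def)
  have "emeasure (distr lborel borel ((*) c)) (box l u) = emeasure lborel ((*) c -` box l u)"
    by (subst emeasure_distr) auto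
  also have "\<dots> = emeasure (distr lborel borel cplx2) ((*) c -` box l u)"
    by (simp add: distr_cplx2)
  also have "\<dots> = emeasure lborel (R ` B)"
    by (subst emeasure_distr)
       (auto simp: im intro!: borel_open open_vimage continuous_intros)
  also have "\<dots> = emeasure lebesgue (R ` B)"
    using RB by simp
  also have "\<dots> = measure lebesgue (R ` B)"
    using measurable_orthogonal_image[OF R, of B]
    by (intro emeasure_eq_measure2) (auto simp: B)
  also have "\<dots> = measure lebesgue B"
    by (subst measure_orthogonal_image[OF R]) (auto simp: B)
  also have "\<dots> = emeasure lebesgue B"
    by (intro emeasure_eq_measure2[symmetric]) (auto simp: B )
  also have "\<dots> = emeasure (distr lborel borel cplx2) (box l u)"
    by (subst emeasure_distr) (auto simp: B B_def[symmetric])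
  also have "\<dots> = (\<Prod>b\<in>Basis. (u - l) \<bullet> b)"
    unfolding distr_cplx2 by (rule emeasure_lborel_box[OF le])
  finally show "emeasure (distr lborel borel ((*) c)) (box l u) = (\<Prod>b\<in>Basis. (u - l) \<bullet> b)" .
qed simp

section \<open>Area integrals over disks: monomials, polynomials, power series\<close>

lemma emeasure_disk: "0 \<le> r \<Longrightarrow> emeasure lborel (ball (z::complex) r) = ennreal (pi * r\<^sup>2)"
  by (simp add: emeasure_ball unit_ball_vol_2 )

lemma cmod_power_measurable: "(\<lambda>z. cmod z ^ k) \<in> borel_measurable borel"
  by (intro borel_measurable_continuous_onI continuous_intros)

lemma indicator_disk_measurable:
  "(indicator (ball (0::complex) r) :: _ \<Rightarrow> 'b :: {real_normed_vector, zero_neq_one, second_countable_topology}) \<in> borel_measurable borel"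
  by (intro borel_measurable_indicator borel_open open_ball)

lemma indicator_disk_measurable_ennreal:
  "(indicator (ball (0::complex) r) :: _ \<Rightarrow> ennreal) \<in> borel_measurable borel"
  by (intro borel_measurable_indicator borel_open open_ball)

text \<open>This replaces polar coordinates by the area formula for disks. The difference
  \<open>r ^ (2 * n) - cmod z ^ (2 * n)\<close> is integrated first because its layers in
  \<open>z\<close> are the disks \<open>cmod z < s\<close>; for \<open>cmod z ^ (2 * n)\<close>
  itself they would be annuli.\<close>

lemma nn_integral_disk_layer:
  assumes r: "0 \<le> r"
  shows "(\<integral>\<^sup>+z\<in>ball (0::complex) r. ennreal (r ^ (2 * n) - cmod z ^ (2 * n)) \<partial>lborel)
           = ennreal (pi * r ^ (2 * n + 2) * (n / (n + 1)))"
proof (cases "n = 0")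
  case False
  define F where "F s = real (2 * n) * s ^ (2 * n - 1)" for s :: real
  have n2: "Suc (2 * n - Suc 0) = 2 * n" using False by simp
  \<comment> \<open>Tonelli after writing \<open>r ^ (2 * n) - cmod z ^ (2 * n)\<close> as the integral of \<open>F\<close> over \<open>{cmod z..r}\<close>\<close>
  have "(\<integral>\<^sup>+z\<in>ball (0::complex) r. ennreal (r ^ (2 * n) - cmod z ^ (2 * n)) \<partial>lborel)
      = (\<integral>\<^sup>+z. (\<integral>\<^sup>+s. ennreal (F s) * indicator {0..r} s * indicator {(z, s). cmod z < s} (z, s) \<partial>lborel) \<partial>lborel)"
  proof (rule nn_integral_cong)
    fix z :: complex
    show "ennreal (r ^ (2 * n) - cmod z ^ (2 * n)) * indicator (ball 0 r) z
        = (\<integral>\<^sup>+s. ennreal (F s) * indicator {0..r} s * indicator {(z, s). cmod z < s} (z, s) \<partial>lborel)"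
    proof (cases "cmod z < r")
      case True
      have "(\<integral>\<^sup>+s. ennreal (F s) * indicator {0..r} s * indicator {(z, s). cmod z < s} (z, s) \<partial>lborel)
         = (\<integral>\<^sup>+s. ennreal (F s) * indicator {cmod z..r} s \<partial>lborel)"
      proof (intro nn_integral_cong_AE)
        show "AE s in lborel. ennreal (F s) * indicator {0..r} s * indicator {(z, s). cmod z < s} (z, s)
           = ennreal (F s) * indicator {cmod z..r} s"
          \<comment> \<open>The two integrands can differ only at \<open>s = cmod z\<close>, where
            one inequality is strict and the other is not.\<close>
          using AE_lborel_singleton[of "cmod z"]
        proof eventually_elim
          case (elim s)
          then show ?case using order_trans[OF norm_ge_zero[of z], of s] True
            by (auto simp: indicator_def)
        qed
      qed
      also have "\<dots> = ennreal (r ^ (2 * n) - cmod z ^ (2 * n))"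
      proof (rule nn_integral_FTC_Icc)
        show "F \<in> borel_measurable borel" unfolding F_def by measurable
        show "((\<lambda>s. s ^ (2 * n)) has_real_derivative F s) (at s)" if "s \<in> {cmod z..r}" for s
          unfolding F_def by (auto intro!: derivative_eq_intros)
        show "0 \<le> F s" if "s \<in> {cmod z..r}" for s
          unfolding F_def using that order_trans[OF norm_ge_zero, of z s]
          by (intro mult_nonneg_nonneg zero_le_power) auto
      qed (use True in auto)
      finally show ?thesis using True by simp
    next
      case False
      then have *: "ennreal (F s) * indicator {0..r} s * indicator {(z, s). cmod z < s} (z, s) = 0" for s
        by (auto simp: indicator_def)
      show ?thesis unfolding * using False by simp
    qed
  qed
  also have "\<dots> = (\<integral>\<^sup>+s. (\<integral>\<^sup>+z. ennreal (F s) * indicator {0..r} s * indicator {(z, s). cmod z < s} (z, s) \<partial>lborel) \<partial>lborel)"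
  proof (rule lborel_pair.Fubini'[symmetric])
    show "(\<lambda>(z, s). ennreal (F s) * indicator {0..r} s * indicator {(z, s). cmod z < s} (z, s))
       \<in> borel_measurable (lborel \<Otimes>\<^sub>M lborel)"
      unfolding F_def by measurable
  qed
  also have "\<dots> = (\<integral>\<^sup>+s. ennreal (F s * (pi * s\<^sup>2)) * indicator {0..r} s \<partial>lborel)"
  proof (rule nn_integral_cong)
    fix s :: real
    have "(\<integral>\<^sup>+z. ennreal (F s) * indicator {0..r} s * indicator {(z, s). cmod z < s} (z::complex, s) \<partial>lborel)
       = (\<integral>\<^sup>+z. ennreal (F s) * indicator {0..r} s * indicator (ball (0::complex) s) z \<partial>lborel)"
      by (intro nn_integral_cong) (auto simp: indicator_def)
    also have "\<dots> = ennreal (F s) * indicator {0..r} s * emeasure lborel (ball (0::complex) s)"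
      by (subst nn_integral_cmult_indicator) auto
    also have "\<dots> = ennreal (F s * (pi * s\<^sup>2)) * indicator {0..r} s"
      by (auto simp: indicator_def emeasure_disk F_def ennreal_mult'[symmetric] mult_ac)
    finally show "(\<integral>\<^sup>+z. ennreal (F s) * indicator {0..r} s * indicator {(z, s). cmod z < s} (z::complex, s) \<partial>lborel)
      = ennreal (F s * (pi * s\<^sup>2)) * indicator {0..r} s" .
  qed
  also have "\<dots> = ennreal (pi * r ^ (2 * n + 2) * (n / (n + 1)) - pi * 0 ^ (2 * n + 2) * (n / (n + 1)))"
  proof (rule nn_integral_FTC_Icc)
    show "(\<lambda>s. F s * (pi * s\<^sup>2)) \<in> borel_measurable borel" unfolding F_def by measurable
    show "((\<lambda>s. pi * s ^ (2 * n + 2) * (n / (n + 1))) has_real_derivative F s * (pi * s\<^sup>2)) (at s)" if "s \<in> {0..r}" for s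
    proof -
      have e: "s ^ (2 * n - 1) * s\<^sup>2 = s ^ (2 * n + 1)"
        using False by (simp flip: power_add)
      have "((\<lambda>s. pi * s ^ (2 * n + 2) * (n / (n + 1))) has_real_derivative
           pi * (real (2 * n + 2) * s ^ (2 * n + 1)) * (n / (n + 1))) (at s)"
        by (rule DERIV_cong[OF DERIV_cmult_right[OF DERIV_cmult[OF DERIV_pow]]]) simp
      also have "pi * (real (2 * n + 2) * s ^ (2 * n + 1)) * (n / (n + 1)) = F s * (pi * s\<^sup>2)"
        unfolding F_def e[symmetric] by (simp add: field_simps)
      finally show ?thesis .
    qed
    show "0 \<le> F s * (pi * s\<^sup>2)" if "s \<in> {0..r}" for s
      unfolding F_def using that by (intro mult_nonneg_nonneg zero_le_power) auto
  qed (use r in auto)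
  finally show ?thesis by (simp add: add.commute)
qed simp

text \<open>Together with the layer integral this one gives \<open>r ^ (2 * n)\<close> times the
  area of the disk. The layer integral is finite, so it can be cancelled from both sides in
  \<open>ennreal\<close>.\<close>

lemma nn_integral_disk_power:
  assumes r: "0 \<le> r"
  shows "(\<integral>\<^sup>+z\<in>ball (0::complex) r. ennreal (cmod z ^ (2 * n)) \<partial>lborel)
           = ennreal (pi * r ^ (2 * n + 2) / (n + 1))"
proof -
  let ?P = "\<integral>\<^sup>+z\<in>ball (0::complex) r. ennreal (cmod z ^ (2 * n)) \<partial>lborel"
  let ?A = "pi * r ^ (2 * n + 2) * (n / (n + 1))" and ?B = "pi * r ^ (2 * n + 2) / (n + 1)"
  have nn: "?A \<ge> 0" "?B \<ge> 0" using r by auto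
  have m: "(\<lambda>z::complex. ennreal (cmod z ^ (2 * n)) * indicator (ball 0 r) z) \<in> borel_measurable borel"
    "(\<lambda>z::complex. ennreal (r ^ (2 * n) - cmod z ^ (2 * n)) * indicator (ball 0 r) z) \<in> borel_measurable borel"
    using cmod_power_measurable[of "2 * n"]
    by (intro borel_measurable_times_ennreal measurable_compose[OF _ measurable_ennreal]
          borel_measurable_diff indicator_disk_measurable_ennreal; simp)+
  have "?P + ennreal ?A = (\<integral>\<^sup>+z. (ennreal (cmod z ^ (2 * n)) * indicator (ball 0 r) z
      + ennreal (r ^ (2 * n) - cmod z ^ (2 * n)) * indicator (ball 0 r) z) \<partial>lborel)"
    by (subst nn_integral_add) (simp_all add: m nn_integral_disk_layer[OF r, of n, simplified] add.commute)
  also have "\<dots> = (\<integral>\<^sup>+z. ennreal (r ^ (2 * n)) * indicator (ball 0 r) (z::complex) \<partial>lborel)"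
    by (intro nn_integral_cong)
       (auto simp: indicator_def ennreal_plus[symmetric] power_mono simp del: ennreal_plus)
  also have "\<dots> = ennreal (r ^ (2 * n) * (pi * r\<^sup>2))"
    using r by (subst nn_integral_cmult_indicator) (auto simp: emeasure_disk ennreal_mult'[symmetric])
  also have "r ^ (2 * n) * (pi * r\<^sup>2) = pi * r ^ (2 * n + 2) * ((1 + n) / (n + 1))"
    by (simp add: power_add power2_eq_square)
  also have "\<dots> = ?B + ?A"
    by (simp only: add_divide_distrib distrib_left of_nat_add) simp
  also have "ennreal (?B + ?A) = ennreal ?B + ennreal ?A"
    by (rule ennreal_plus[OF nn(2,1)])
  finally show ?thesis by (simp add: add.commute[of _ "ennreal ?A"])
qed

lemma continuous_set_integrable_disk:
  fixes f :: "complex \<Rightarrow> 'b :: euclidean_space"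
  assumes "continuous_on UNIV f"
  shows "set_integrable lborel (ball 0 r) f"
proof -
  have "set_integrable lborel (cball 0 r) f"
    unfolding set_integrable_def
    by (intro borel_integrable_compact continuous_on_subset[OF assms]) auto
  then show ?thesis by (rule set_integrable_subset) auto
qed

lemma integral_disk_orthogonal:
  assumes nm: "n \<noteq> (m::nat)"
  shows "(LINT z:ball 0 r|lborel. z ^ n * cnj z ^ m) = 0"
proof -
  \<comment> \<open>The rotation by \<open>\<theta>\<close> preserves the disk and changes the sign of the integrand.\<close>
  define \<theta> where "\<theta> = pi / (real n - real m)"
  define c where "c = cis \<theta>"
  have c1: "cmod c = 1" by (simp add: c_def)
  have cc: "c ^ n * cnj c ^ m = -1"
  proof -
    have "c ^ n * cnj c ^ m = cis (real n * \<theta>) * cis (- (real m * \<theta>))"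
      by (simp add: c_def Complex.DeMoivre cis_cnj)
    also have "\<dots> = cis ((real n - real m) * \<theta>)"
      by (simp add: cis_mult algebra_simps)
    also have "(real n - real m) * \<theta> = pi"
      using nm by (simp add: \<theta>_def)
    finally show ?thesis by simp
  qed
  let ?f = "\<lambda>z::complex. indicator (ball 0 r) z *\<^sub>R (z ^ n * cnj z ^ m)"
  have m: "?f \<in> borel_measurable borel"
    by (intro borel_measurable_scaleR borel_measurable_indicator borel_measurable_continuous_onI continuous_intros) auto
  have "integral\<^sup>L lborel ?f = integral\<^sup>L (distr lborel borel ((*) c)) ?f"
    by (simp add: distr_lborel_rotation[OF c1])
  also have "\<dots> = integral\<^sup>L lborel (\<lambda>z. ?f (c * z))"
    by (rule integral_distr) (use m in auto)
  also have "(\<lambda>z. ?f (c * z)) = (\<lambda>z. - ?f z)"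
  proof
    fix z
    have "(c * z) ^ n * cnj (c * z) ^ m = (c ^ n * cnj c ^ m) * (z ^ n * cnj z ^ m)"
      by (simp add: power_mult_distrib)
    then show "?f (c * z) = - ?f z"
      using c1 by (simp add: cc indicator_def norm_mult)
  qed
  finally show ?thesis
    unfolding set_lebesgue_integral_def by simp
qed

lemma integral_disk_power:
  assumes r: "0 \<le> r"
  shows "(LINT z:ball (0::complex) r|lborel. cmod z ^ (2 * n)) = pi * r ^ (2 * n + 2) / (n + 1)"
proof -
  have "integral\<^sup>L lborel (\<lambda>z::complex. indicator (ball 0 r) z *\<^sub>R cmod z ^ (2 * n)) = pi * r ^ (2 * n + 2) / (n + 1)"
  proof (rule integral_eq_nn_integral[THEN trans])
    show "(\<lambda>z::complex. indicator (ball 0 r) z *\<^sub>R cmod z ^ (2 * n)) \<in> borel_measurable lborel"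
      using cmod_power_measurable[of "2 * n"] indicator_disk_measurable
      by (intro borel_measurable_scaleR) auto
    have "(\<integral>\<^sup>+z. ennreal (indicator (ball (0::complex) r) z *\<^sub>R cmod z ^ (2 * n)) \<partial>lborel) = 
      (\<integral>\<^sup>+z\<in>ball (0::complex) r. ennreal (cmod z ^ (2 * n)) \<partial>lborel)"
      by (intro nn_integral_cong) (auto simp: indicator_def)
    then show "enn2real (\<integral>\<^sup>+z. ennreal (indicator (ball (0::complex) r) z *\<^sub>R cmod z ^ (2 * n)) \<partial>lborel) = pi * r ^ (2 * n + 2) / (n + 1)"
      using r by (simp add: nn_integral_disk_power)
  qed auto
  then show ?thesis by (simp add: set_lebesgue_integral_def)
qed

lemma integral_disk_polynomial:
  assumes r: "0 \<le> r"
  shows "(LINT z:ball (0::complex) r|lborel. (cmod (\<Sum>n<N. c n * z ^ n))\<^sup>2)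
      = (\<Sum>n<N. (cmod (c n))\<^sup>2 * (pi * r ^ (2 * n + 2) / (n + 1)))"
proof -
  let ?D = "ball (0::complex) r"
  have int: "integrable lborel (\<lambda>z. indicator ?D z *\<^sub>R ((c n * cnj (c m)) * (z ^ n * cnj z ^ m)))" for n m
    unfolding set_integrable_def[symmetric] by (intro continuous_set_integrable_disk continuous_intros)
  have "complex_of_real (LINT z:?D|lborel. (cmod (\<Sum>n<N. c n * z ^ n))\<^sup>2)
     = (LINT z:?D|lborel. complex_of_real ((cmod (\<Sum>n<N. c n * z ^ n))\<^sup>2))"
    by (rule set_integral_complex_of_real[symmetric])
  also have "\<dots> = (LINT z:?D|lborel. (\<Sum>n<N. \<Sum>m<N. (c n * cnj (c m)) * (z ^ n * cnj z ^ m)))"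
    by (simp add: complex_norm_square sum_product mult_ac del: of_real_power)
  also have "\<dots> = (\<Sum>n<N. \<Sum>m<N. LINT z:?D|lborel. (c n * cnj (c m)) * (z ^ n * cnj z ^ m))"
    unfolding set_lebesgue_integral_def scaleR_sum_right
    by (simp only: Bochner_Integration.integral_sum Bochner_Integration.integrable_sum int)
  also have "\<dots> = (\<Sum>n<N. \<Sum>m<N. (c n * cnj (c m)) * (LINT z:?D|lborel. z ^ n * cnj z ^ m))"
    by simp
  also have "\<dots> = (\<Sum>n<N. \<Sum>m<N. if m = n then (c n * cnj (c n)) * (LINT z:?D|lborel. z ^ n * cnj z ^ n) else 0)"
    by (intro sum.cong refl) (auto simp: integral_disk_orthogonal)
  also have "\<dots> = (\<Sum>n<N. (c n * cnj (c n)) * (LINT z:?D|lborel. z ^ n * cnj z ^ n))"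
    by simp
  also have "\<dots> = (\<Sum>n<N. of_real ((cmod (c n))\<^sup>2 * (pi * r ^ (2 * n + 2) / (n + 1))))"
  proof (intro sum.cong refl)
    fix n
    have "z ^ n * cnj z ^ n = complex_of_real (cmod z ^ (2 * n))" for z
      by (simp add: power_mult_distrib[symmetric] complex_norm_square[symmetric] power_mult)
    then have "(LINT z:?D|lborel. z ^ n * cnj z ^ n) = complex_of_real (pi * r ^ (2 * n + 2) / (n + 1))"
      using integral_disk_power[OF r, of n] by (simp only: set_integral_complex_of_real)
    moreover have "c n * cnj (c n) = complex_of_real ((cmod (c n))\<^sup>2)"
      by (rule complex_norm_square[symmetric])
    ultimately show "(c n * cnj (c n)) * (LINT z:?D|lborel. z ^ n * cnj z ^ n) =
       of_real ((cmod (c n))\<^sup>2 * (pi * r ^ (2 * n + 2) / (n + 1)))" by simp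
  qed
  finally show ?thesis
    unfolding of_real_sum[symmetric] of_real_eq_iff .
qed

text \<open>On a disk of radius \<open>r < 1\<close> the partial sums have a common bound, so
  dominated convergence carries the polynomial formula over to \<open>g\<close>. Measurability is a
  conclusion because \<open>g\<close> is only given as a pointwise sum; it is inherited from the
  partial sums.\<close>

lemma nn_integral_disk_power_series_radius:
  assumes sm: "\<And>z. z \<in> \<bbbD> \<Longrightarrow> (\<lambda>n. c n * z ^ n) sums g z"
    and r: "0 \<le> r" "r < 1"
  shows "(\<integral>\<^sup>+z. ennreal (indicator (ball 0 r) z * (cmod (g z))\<^sup>2) \<partial>lborel)
     = (\<Sum>n. ennreal ((cmod (c n))\<^sup>2 * (pi * r ^ (2 * n + 2) / (n + 1))))"
    and "(\<lambda>z. indicator (ball 0 r) z * (cmod (g z))\<^sup>2) \<in> borel_measurable lborel"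
proof -
  let ?D = "ball (0::complex) r"
  define p where "p N z = indicator ?D z * (cmod (\<Sum>n<N. c n * z ^ n))\<^sup>2" for N and z :: complex
  define q where "q z = indicator ?D z * (cmod (g z))\<^sup>2" for z
  define M where "M = (\<Sum>n. cmod (c n) * r ^ n)"
  have sumM: "summable (\<lambda>n. cmod (c n) * r ^ n)"
  proof -
    \<comment> \<open>The midpoint of \<open>r\<close> and 1 lies in the disk and beyond
      \<open>r\<close>; convergence there forces absolute convergence at \<open>r\<close>.\<close>
    have "summable (\<lambda>n. c n * of_real ((1 + r) / 2) ^ n)"
      using sm[of "of_real ((1 + r) / 2)"] r by (intro sums_summable) (auto simp flip: of_real_add)
    from powser_insidea[OF this, of "of_real r"] r show ?thesis
      by (simp add: norm_mult norm_power flip: of_real_add)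
  qed
  have pm: "p N \<in> borel_measurable lborel" for N
    unfolding p_def
    by (intro borel_measurable_times borel_measurable_indicator)
       (auto intro!: borel_open borel_measurable_continuous_onI continuous_intros)
  have lim: "(\<lambda>N. p N z) \<longlonglongrightarrow> q z" for z
  proof (cases "z \<in> ?D")
    case True
    then have "z \<in> \<bbbD>" using r by auto
    from sm[OF this] show ?thesis
      unfolding p_def q_def sums_def by (intro tendsto_intros)
  qed (simp add: p_def q_def)
  have qm: "q \<in> borel_measurable lborel"
    by (rule borel_measurable_LIMSEQ_real[OF lim pm])
  have bound: "AE z in lborel. norm (p N z) \<le> indicator ?D z *\<^sub>R M\<^sup>2" for N
  proof (intro AE_I2)
    fix z :: complex
    have "cmod (\<Sum>n<N. c n * z ^ n) \<le> M" if z: "z \<in> ?D"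
    proof -
      have "cmod (\<Sum>n<N. c n * z ^ n) \<le> (\<Sum>n<N. cmod (c n) * r ^ n)"
        using z by (intro order_trans[OF norm_sum] sum_mono)
                   (auto simp: norm_mult norm_power intro!: mult_left_mono power_mono)
      also have "\<dots> \<le> M"
        unfolding M_def using r by (intro sum_le_suminf sumM) auto
      finally show ?thesis .
    qed
    then show "norm (p N z) \<le> indicator ?D z *\<^sub>R M\<^sup>2"
      by (auto simp: p_def indicator_def intro!: power_mono)
  qed
  have w: "integrable lborel (\<lambda>z. indicator ?D z *\<^sub>R M\<^sup>2)"
    by (intro integrable_scaleR_left) (simp add: integrable_indicator_iff emeasure_ball r)
  have qi: "integrable lborel q"
    by (rule integrable_dominated_convergence[OF qm pm w AE_I2[OF lim] bound])
  have "(\<lambda>N. integral\<^sup>L lborel (p N)) \<longlonglongrightarrow> integral\<^sup>L lborel q"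
    by (rule integral_dominated_convergence[OF qm pm w AE_I2[OF lim] bound])
  also have "(\<lambda>N. integral\<^sup>L lborel (p N))
       = (\<lambda>N. \<Sum>n<N. (cmod (c n))\<^sup>2 * (pi * r ^ (2 * n + 2) / (n + 1)))"
    using integral_disk_polynomial[OF r(1)] by (simp add: p_def[abs_def] set_lebesgue_integral_def)
  finally have "(\<lambda>n. (cmod (c n))\<^sup>2 * (pi * r ^ (2 * n + 2) / (n + 1))) sums integral\<^sup>L lborel q"
    unfolding sums_def .
  then have "(\<Sum>n. ennreal ((cmod (c n))\<^sup>2 * (pi * r ^ (2 * n + 2) / (n + 1)))) = ennreal (integral\<^sup>L lborel q)"
    using r by (intro suminf_ennreal_eq) auto
  also have "\<dots> = (\<integral>\<^sup>+z. ennreal (q z) \<partial>lborel)"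
    by (intro nn_integral_eq_integral[symmetric] qi) (auto simp: q_def)
  finally show "(\<integral>\<^sup>+z. ennreal (indicator (ball 0 r) z * (cmod (g z))\<^sup>2) \<partial>lborel)
     = (\<Sum>n. ennreal ((cmod (c n))\<^sup>2 * (pi * r ^ (2 * n + 2) / (n + 1))))"
    by (simp add: q_def)
  show "(\<lambda>z. indicator (ball 0 r) z * (cmod (g z))\<^sup>2) \<in> borel_measurable lborel"
    using qm by (simp add: q_def[abs_def])
qed

text \<open>Let the radius increase to 1: monotone convergence applies to the area integral and,
  with counting measure, to the series. Both sides may be infinite, so the identity serves as a
  criterion for membership in the Dirichlet space as well as a formula for the norm.\<close>

lemma nn_integral_disk_power_series:
  assumes sm: "\<And>z. z \<in> \<bbbD> \<Longrightarrow> (\<lambda>n. c n * z ^ n) sums g z"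
  shows "(\<integral>\<^sup>+z. ennreal (indicator \<bbbD> z * (cmod (g z))\<^sup>2) \<partial>lborel)
     = (\<Sum>n. ennreal (pi * (cmod (c n))\<^sup>2 / (n + 1)))"
proof -
  define r where "r k = 1 - 1 / (real k + 2)" for k
  have r: "0 \<le> r k" "r k < 1" for k by (auto simp: r_def field_simps)
  have rm: "r k \<le> r l" if "k \<le> l" for k l
    using that by (auto simp: r_def intro!: diff_left_mono divide_left_mono)
  have r1: "r \<longlonglongrightarrow> 1" unfolding r_def by real_asymp
  let ?J = "\<lambda>k. \<integral>\<^sup>+z. ennreal (indicator (ball 0 (r k)) z * (cmod (g z))\<^sup>2) \<partial>lborel"
  have "?J \<longlonglongrightarrow> (\<integral>\<^sup>+z. ennreal (indicator \<bbbD> z * (cmod (g z))\<^sup>2) \<partial>lborel)"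
  proof (rule nn_integral_LIMSEQ)
    show "incseq (\<lambda>k z. ennreal (indicator (ball 0 (r k)) z * (cmod (g z))\<^sup>2))"
      using rm by (force simp: incseq_def le_fun_def indicator_def intro!: ennreal_leI)
    show "(\<lambda>z. ennreal (indicator (ball 0 (r k)) z * (cmod (g z))\<^sup>2)) \<in> borel_measurable lborel" for k
      using nn_integral_disk_power_series_radius(2)[OF sm r, of k] by simp
    fix z :: complex
    show "(\<lambda>k. ennreal (indicator (ball 0 (r k)) z * (cmod (g z))\<^sup>2)) \<longlonglongrightarrow> ennreal (indicator \<bbbD> z * (cmod (g z))\<^sup>2)"
    proof (cases "z \<in> \<bbbD>")
      case True
      then have "\<forall>\<^sub>F k in sequentially. cmod z < r k"
        by (intro order_tendstoD[OF r1]) auto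
      then have "\<forall>\<^sub>F k in sequentially. ennreal (indicator (ball 0 (r k)) z * (cmod (g z))\<^sup>2) = ennreal (indicator \<bbbD> z * (cmod (g z))\<^sup>2)"
        by eventually_elim (use True in auto)
      then show ?thesis by (rule tendsto_eventually)
    next
      case False
      then have "z \<notin> ball 0 (r k)" for k using r(2)[of k] by auto
      with False show ?thesis by simp
    qed
  qed
  moreover have "?J \<longlonglongrightarrow> (\<Sum>n. ennreal (pi * (cmod (c n))\<^sup>2 / (n + 1)))"
  proof -
  have J: "?J = (\<lambda>k. \<Sum>n. ennreal ((cmod (c n))\<^sup>2 * (pi * r k ^ (2 * n + 2) / (n + 1))))"
    by (intro ext nn_integral_disk_power_series_radius(1)[OF sm r])
  show ?thesis
    unfolding J nn_integral_count_space_nat[symmetric]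
  proof (rule nn_integral_LIMSEQ)
    show "incseq (\<lambda>k n. ennreal ((cmod (c n))\<^sup>2 * (pi * r k ^ (2 * n + 2) / real (n + 1))))"
      using rm r unfolding incseq_def le_fun_def
      by (intro allI impI ennreal_leI mult_left_mono divide_right_mono power_mono) auto
    show "(\<lambda>k. ennreal ((cmod (c n))\<^sup>2 * (pi * r k ^ (2 * n + 2) / real (n + 1))))
       \<longlonglongrightarrow> ennreal (pi * (cmod (c n))\<^sup>2 / real (n + 1))" for n
    proof -
      have "(\<lambda>k. (cmod (c n))\<^sup>2 * (pi * r k ^ (2 * n + 2) / real (n + 1)))
         \<longlonglongrightarrow> (cmod (c n))\<^sup>2 * (pi * 1 ^ (2 * n + 2) / real (n + 1))"
        by (intro tendsto_intros r1) auto
      then show ?thesis by (intro tendsto_ennrealI) (simp add: mult_ac)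
    qed
  qed simp
  qed
  ultimately show ?thesis by (rule LIMSEQ_unique)
qed

section \<open>The Dirichlet space as a weighted sequence space\<close>

lemma taylor_coeff_sums:
  assumes "f holomorphic_on \<bbbD>" "z \<in> \<bbbD>"
  shows "(\<lambda>n. taylor_coeff f n * z ^ n) sums f z"
  using holomorphic_power_series[OF assms] by (simp add: taylor_coeff_def)

lemma taylor_coeff_unique:
  assumes sm: "\<And>z. z \<in> \<bbbD> \<Longrightarrow> (\<lambda>n. c n * z ^ n) sums f z"
  shows "taylor_coeff f = c"
proof
  fix n
  have "f has_fps_expansion Abs_fps c"
    unfolding has_fps_expansion_def
  proof
    have "norm (1 / 2 :: complex) \<le> conv_radius c"
      by (rule conv_radius_geI[OF sums_summable[OF sm]]) (simp add: norm_divide)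
    then show "fps_conv_radius (Abs_fps c) > 0"
      unfolding fps_conv_radius_def by (simp add: norm_divide) (auto intro: less_le_trans[rotated])
    have "eventually (\<lambda>z. z \<in> \<bbbD>) (nhds (0::complex))"
      by (rule eventually_nhds_in_open) auto
    then show "eventually (\<lambda>z. eval_fps (Abs_fps c) z = f z) (nhds 0)"
      by eventually_elim (use sm in \<open>simp add: eval_fps_def sums_iff\<close>)
  qed
  from fps_nth_fps_expansion[OF this, of n] show "taylor_coeff f n = c n"
    by (simp add: taylor_coeff_def)
qed

lemma deriv_taylor_sums:
  assumes "f holomorphic_on \<bbbD>" "z \<in> \<bbbD>"
  shows "(\<lambda>n. (of_nat (Suc n) * taylor_coeff f (Suc n)) * z ^ n) sums deriv f z"
proof -
  have "(deriv ^^ n) (deriv f) 0 / fact n = of_nat (Suc n) * taylor_coeff f (Suc n)" for n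
    by (simp add: taylor_coeff_def funpow_Suc_right fact_Suc field_simps del: funpow.simps of_nat_Suc)
  then show ?thesis
    using holomorphic_power_series[of "deriv f" 0 1 z] holomorphic_deriv[OF assms(1)] assms(2) by simp
qed

lemma nn_integral_deriv_square:
  assumes "f holomorphic_on \<bbbD>"
  shows "(\<integral>\<^sup>+z. ennreal (indicator \<bbbD> z * (cmod (deriv f z))\<^sup>2) \<partial>lborel)
     = (\<Sum>n. ennreal (pi * (real (Suc n) * (cmod (taylor_coeff f (Suc n)))\<^sup>2)))"
proof -
  have "pi * (cmod (of_nat (Suc n) * t))\<^sup>2 / real (n + 1) = pi * (real (Suc n) * (cmod t)\<^sup>2)" for n t
    unfolding Suc_eq_plus1[symmetric]
    by (simp add: norm_mult power_mult_distrib power2_eq_square del: of_nat_Suc)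
  then show ?thesis
    using nn_integral_disk_power_series[OF deriv_taylor_sums[OF assms]] by (simp only:)
qed

lemma dirichlet_integral_sums:
  assumes f: "f \<in> dirichlet_space"
  shows "(\<lambda>n. real n * (cmod (taylor_coeff f n))\<^sup>2) sums ((LINT z:\<bbbD>|lborel. (cmod (deriv f z))\<^sup>2) / pi)"
proof -
  let ?I = "LINT z:\<bbbD>|lborel. (cmod (deriv f z))\<^sup>2"
  let ?a = "\<lambda>n. pi * (real (Suc n) * (cmod (taylor_coeff f (Suc n)))\<^sup>2)"
  have "(\<Sum>n. ennreal (?a n)) = (\<integral>\<^sup>+z. ennreal (indicator \<bbbD> z * (cmod (deriv f z))\<^sup>2) \<partial>lborel)"
    by (rule nn_integral_deriv_square[OF dirichlet_space_holo[OF f], symmetric])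
  also have "\<dots> = ennreal ?I"
    unfolding set_lebesgue_integral_def real_scaleR_def
    using dirichlet_space_integrable[OF f]
    by (intro nn_integral_eq_integral) (auto simp: set_integrable_def)
  finally have eq: "(\<Sum>n. ennreal (?a n)) = ennreal ?I" .
  have "summable ?a"
    by (rule summable_suminf_not_top) (simp_all add: eq del: of_nat_Suc)
  then have "?a sums suminf ?a" by (rule summable_sums)
  moreover have "ennreal (suminf ?a) = ennreal ?I"
    unfolding eq[symmetric] by (rule suminf_ennreal2[symmetric, OF _ \<open>summable ?a\<close>]) simp
  then have "suminf ?a = ?I"
    using suminf_nonneg[OF \<open>summable ?a\<close>] dirichlet_integral_nonneg[of f] by (subst (asm) ennreal_inj) auto
  ultimately have "(\<lambda>n. ?a n / pi) sums (?I / pi)"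
    using sums_divide by metis
  then have "(\<lambda>n. real (Suc n) * (cmod (taylor_coeff f (Suc n)))\<^sup>2) sums (?I / pi)"
    by simp
  \<comment> \<open>Undoing the index shift costs nothing, since the term at 0 has weight 0.\<close>
  then show ?thesis by (subst (asm) sums_Suc_iff) simp
qed

lemma dirichlet_norm_sums:
  assumes f: "f \<in> dirichlet_space"
  shows "(\<lambda>n. real (max 1 n) * (cmod (taylor_coeff f n))\<^sup>2) sums (dirichlet_norm f)\<^sup>2"
proof -
  let ?a = "\<lambda>n. (cmod (taylor_coeff f n))\<^sup>2"
  have "(\<lambda>n. (if n = 0 then ?a n else 0) + real n * ?a n) sums (dirichlet_norm f)\<^sup>2"
    using sums_add[OF sums_single[of 0 ?a] dirichlet_integral_sums[OF f]]
    unfolding dirichlet_norm_power2 by (simp add: taylor_coeff_def)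
  also have "(\<lambda>n. (if n = 0 then ?a n else 0) + real n * ?a n) = (\<lambda>n. real (max 1 n) * ?a n)"
    by (auto simp: max_def)
  finally show ?thesis .
qed

text \<open>The exact weight of the norm is \<open>max 1 n\<close>. The weight \<open>n + 1\<close>
  differs from it by a factor of at most 2 and fits the Hankel structure better, since it treats
  \<open>n = 0\<close> like every other index and grows under the shift
  \<open>n + k\<close>.\<close>

lemma dirichlet_space_weighted_sum:
  assumes f: "f \<in> dirichlet_space"
  shows "summable (\<lambda>n. real (Suc n) * (cmod (taylor_coeff f n))\<^sup>2)"
    and "(\<Sum>n. real (Suc n) * (cmod (taylor_coeff f n))\<^sup>2) \<le> 2 * (dirichlet_norm f)\<^sup>2"
    and "(dirichlet_norm f)\<^sup>2 \<le> (\<Sum>n. real (Suc n) * (cmod (taylor_coeff f n))\<^sup>2)"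
proof -
  let ?a = "\<lambda>n. (cmod (taylor_coeff f n))\<^sup>2"
  note s = dirichlet_norm_sums[OF f]
  have b: "(\<lambda>n. 2 * (real (max 1 n) * ?a n)) sums (2 * (dirichlet_norm f)\<^sup>2)"
    by (intro sums_mult s)
  have le: "real (Suc n) * ?a n \<le> 2 * (real (max 1 n) * ?a n)" for n
    unfolding mult.assoc[symmetric] by (intro mult_right_mono) auto
  show sm: "summable (\<lambda>n. real (Suc n) * ?a n)"
    by (rule summable_comparison_test'[OF sums_summable[OF b], of 0]) (use le in auto)
  show "(\<Sum>n. real (Suc n) * ?a n) \<le> 2 * (dirichlet_norm f)\<^sup>2"
    unfolding sums_unique[OF b] by (rule suminf_le[OF le sm sums_summable[OF b]])
  show "(dirichlet_norm f)\<^sup>2 \<le> (\<Sum>n. real (Suc n) * ?a n)"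
    unfolding sums_unique[OF s]
    by (rule suminf_le[OF _ sums_summable[OF s] sm]) (auto intro!: mult_right_mono)
qed

text \<open>The weighted terms tend to 0, hence the coefficients are bounded and a geometric series
  dominates.\<close>

lemma
  assumes c: "summable (\<lambda>n. real (Suc n) * (cmod (c n))\<^sup>2)"
  shows power_series_fun_sums: "z \<in> \<bbbD> \<Longrightarrow> (\<lambda>n. c n * z ^ n) sums power_series_fun c z"
    and weighted_converges_on_disk: "converges_on_disk c"
proof -
  have "(\<lambda>n. real (Suc n) * (cmod (c n))\<^sup>2) \<longlonglongrightarrow> 0"
    by (rule summable_LIMSEQ_zero[OF c])
  then have "Bseq (\<lambda>n. real (Suc n) * (cmod (c n))\<^sup>2)"
    by (intro convergent_imp_Bseq convergentI)
  then obtain B where "\<And>n. norm (real (Suc n) * (cmod (c n))\<^sup>2) \<le> B"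
    by (auto simp: Bseq_def)
  moreover have "(cmod (c n))\<^sup>2 \<le> norm (real (Suc n) * (cmod (c n))\<^sup>2)" for n
    by (simp add: algebra_simps)
  ultimately have B: "(cmod (c n))\<^sup>2 \<le> B" for n
    using order_trans by blast
  have S: "summable (\<lambda>n. c n * z ^ n)" if z: "z \<in> \<bbbD>" for z
  proof (rule summable_comparison_test')
    show "summable (\<lambda>n. sqrt B * cmod z ^ n)"
      using z by (intro summable_mult summable_geometric) auto
    show "norm (c n * z ^ n) \<le> sqrt B * cmod z ^ n" for n
      using B[of n] by (auto simp: norm_mult norm_power intro!: mult_right_mono real_le_rsqrt)
  qed
  then show "converges_on_disk c" by (simp add: converges_on_disk_def)
  show "z \<in> \<bbbD> \<Longrightarrow> (\<lambda>n. c n * z ^ n) sums power_series_fun c z"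
    using S[of z] by (simp add: power_series_fun_def summable_sums)
qed

text \<open>The converse half of the description by coefficients: the area integral of the squared
  derivative is evaluated in \<open>ennreal\<close> first, and its finiteness is what gives
  integrability.\<close>

lemma
  assumes c: "summable (\<lambda>n. real (Suc n) * (cmod (c n))\<^sup>2)"
  shows taylor_coeff_power_series_fun: "taylor_coeff (power_series_fun c) = c"
    and power_series_fun_dirichlet: "power_series_fun c \<in> dirichlet_space"
proof -
  let ?f = "power_series_fun c"
  show t: "taylor_coeff ?f = c"
    by (rule taylor_coeff_unique[OF power_series_fun_sums[OF c]])
  have h: "?f holomorphic_on \<bbbD>"
    by (rule power_series_holomorphic[of 0 1 c]) (use power_series_fun_sums[OF c] in simp)
  have "summable (\<lambda>n. real (Suc n) * (cmod (c (Suc n)))\<^sup>2)"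
  proof (rule summable_comparison_test'[of _ 0])
    show "summable (\<lambda>n. real (Suc (Suc n)) * (cmod (c (Suc n)))\<^sup>2)"
      using c by (subst summable_Suc_iff)
  qed (auto intro!: mult_right_mono)
  then have s: "summable (\<lambda>n. pi * (real (Suc n) * (cmod (c (Suc n)))\<^sup>2))"
    by (rule summable_mult)
  have "set_integrable lborel \<bbbD> (\<lambda>z. (cmod (deriv ?f z))\<^sup>2)"
    unfolding set_integrable_def
  proof (rule integrableI_nonneg)
    show "(\<lambda>z. indicator \<bbbD> z *\<^sub>R (cmod (deriv ?f z))\<^sup>2) \<in> borel_measurable lborel"
      using deriv_sq_set_measurable[OF h] by (simp add: set_borel_measurable_def)
    have "(\<integral>\<^sup>+z. ennreal (indicator \<bbbD> z *\<^sub>R (cmod (deriv ?f z))\<^sup>2) \<partial>lborel)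
        = ennreal (\<Sum>n. pi * (real (Suc n) * (cmod (c (Suc n)))\<^sup>2))"
      unfolding real_scaleR_def nn_integral_deriv_square[OF h] t
      by (rule suminf_ennreal2[OF _ s]) simp
    then show "(\<integral>\<^sup>+z. ennreal (indicator \<bbbD> z *\<^sub>R (cmod (deriv ?f z))\<^sup>2) \<partial>lborel) < \<infinity>"
      by simp
  qed auto
  then show "?f \<in> dirichlet_space"
    using h by (simp add: dirichlet_space_def power_series_fun_def)
qed

lemma taylor_coeff_add:
  assumes "f \<in> dirichlet_space" "g \<in> dirichlet_space"
  shows "taylor_coeff (\<lambda>z. f z + g z) = (\<lambda>n. taylor_coeff f n + taylor_coeff g n)"
  by (rule taylor_coeff_unique)
     (auto simp: ring_distribs intro!: sums_add taylor_coeff_sums dirichlet_space_holo assms)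

lemma taylor_coeff_diff:
  assumes "f \<in> dirichlet_space" "g \<in> dirichlet_space"
  shows "taylor_coeff (\<lambda>z. f z - g z) = (\<lambda>n. taylor_coeff f n - taylor_coeff g n)"
  by (rule taylor_coeff_unique)
     (auto simp: ring_distribs intro!: sums_diff taylor_coeff_sums dirichlet_space_holo assms)

lemma taylor_coeff_cmult:
  assumes "f \<in> dirichlet_space"
  shows "taylor_coeff (\<lambda>z. c * f z) = (\<lambda>n. c * taylor_coeff f n)"
  by (rule taylor_coeff_unique)
     (auto simp: mult.assoc intro!: sums_mult taylor_coeff_sums dirichlet_space_holo assms)

section \<open>Hankel operators with Hilbert-Schmidt Gram matrix\<close>

abbreviation weighted_summable :: "(nat \<Rightarrow> complex) \<Rightarrow> bool" where
  "weighted_summable a \<equiv> summable (\<lambda>n. real (Suc n) * (cmod (a n))\<^sup>2)"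

text \<open>This is \<open>hankel_coeff\<close> freed from analytic functions, so that coefficient
  sequences can be truncated and subtracted directly.\<close>

definition hankel_sum :: "(nat \<Rightarrow> complex) \<Rightarrow> (nat \<Rightarrow> complex) \<Rightarrow> nat \<Rightarrow> complex" where
  "hankel_sum w a n = (\<Sum>k. w (n + k) * a k)"

text \<open>
  In the notation of the introductory remark, \<open>A\<^sup>* A\<close> has the \<open>(l, k)\<close> entry
  \<open>hankel_gram w k l / sqrt ((k + 1) * (l + 1))\<close>, and \<open>gram_sq w k l\<close> is its squared modulus.
\<close>

definition hankel_gram :: "(nat \<Rightarrow> complex) \<Rightarrow> nat \<Rightarrow> nat \<Rightarrow> complex" where
  "hankel_gram w k l = (\<Sum>n. of_nat (Suc n) * (w (n + k) * cnj (w (n + l))))"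

definition gram_sq :: "(nat \<Rightarrow> complex) \<Rightarrow> nat \<Rightarrow> nat \<Rightarrow> real" where
  "gram_sq w k l = (cmod (hankel_gram w k l))\<^sup>2 / (real (Suc k) * real (Suc l))"

lemma gram_sq_nonneg [simp]: "0 \<le> gram_sq w k l"
  by (simp add: gram_sq_def)

lemma weighted_summable_shift:
  assumes "weighted_summable w"
  shows "summable (\<lambda>n. real (Suc n) * (cmod (w (n + k)))\<^sup>2)"
proof (rule summable_comparison_test'[of _ 0])
  show "summable (\<lambda>n. real (Suc (n + k)) * (cmod (w (n + k)))\<^sup>2)"
    using assms by (subst summable_iff_shift)
qed (auto intro!: mult_right_mono)

lemma weighted_summable_imp_square_summable:
  assumes "weighted_summable w"
  shows "summable (\<lambda>n. (cmod (w (n + k)))\<^sup>2)"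
  by (rule summable_comparison_test'[OF weighted_summable_shift[OF assms, of k], of 0])
     (simp add: algebra_simps)

lemma mult_le_mean_squares: "(x::real) * y \<le> (x\<^sup>2 + y\<^sup>2) / 2"
  using sum_squares_bound[of x y] by simp

lemma hankel_sum_summable:
  assumes "weighted_summable w" "weighted_summable a"
  shows "summable (\<lambda>k. w (n + k) * a k)"
proof (rule summable_comparison_test'[of _ 0])
  show "summable (\<lambda>k. ((cmod (w (k + n)))\<^sup>2 + (cmod (a (k + 0)))\<^sup>2) / 2)"
    by (intro summable_divide summable_add weighted_summable_imp_square_summable assms)
  show "norm (w (n + k) * a k) \<le> ((cmod (w (k + n)))\<^sup>2 + (cmod (a (k + 0)))\<^sup>2) / 2" for k
    using mult_le_mean_squares[of "cmod (w (k + n))" "cmod (a k)"]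
    by (simp add: norm_mult add.commute[of k n])
qed

lemma hankel_gram_bound:
  "norm (of_nat (Suc n) * (w (n + k) * cnj (w (n + l)))) 
    \<le> (real (Suc n) * (cmod (w (n + k)))\<^sup>2 + real (Suc n) * (cmod (w (n + l)))\<^sup>2) / 2"
  using mult_left_mono[OF mult_le_mean_squares[of "cmod (w (n + k))" "cmod (w (n + l))"], of "real (Suc n)"]
  by (simp add: norm_mult distrib_left add_divide_distrib del: of_nat_Suc)

lemma hankel_gram_sums:
  assumes "weighted_summable w"
  shows "(\<lambda>n. of_nat (Suc n) * (w (n + k) * cnj (w (n + l)))) sums hankel_gram w k l"
proof -
  have "summable (\<lambda>n. of_nat (Suc n) * (w (n + k) * cnj (w (n + l))))"
  proof (rule summable_comparison_test'[of _ 0])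
    show "summable (\<lambda>n. (real (Suc n) * (cmod (w (n + k)))\<^sup>2 + real (Suc n) * (cmod (w (n + l)))\<^sup>2) / 2)"
      by (intro summable_divide summable_add weighted_summable_shift assms)
  qed (rule hankel_gram_bound)
  then show ?thesis unfolding hankel_gram_def by (rule summable_sums)
qed

text \<open>This is \<open>|A a|^2 = <A* A a, a>\<close> followed by Cauchy-Schwarz over pairs of
  indices, which brings in the Hilbert-Schmidt norm of the Gram block over \<open>A\<close>. A
  finite support keeps the interchange of sums elementary.\<close>

lemma hankel_finite_sum_bound:
  assumes w: "weighted_summable w" and A: "finite A"
  shows "(\<Sum>n<P. real (Suc n) * (cmod (\<Sum>k\<in>A. w (n + k) * a k))\<^sup>2)
     \<le> sqrt (\<Sum>k\<in>A. \<Sum>l\<in>A. gram_sq w k l) * (\<Sum>k\<in>A. real (Suc k) * (cmod (a k))\<^sup>2)"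
proof -
  let ?q = "\<lambda>n. real (Suc n) * (cmod (\<Sum>k\<in>A. w (n + k) * a k))\<^sup>2"
  let ?G = "\<Sum>k\<in>A. \<Sum>l\<in>A. (a k * cnj (a l)) * hankel_gram w k l"
  \<comment> \<open>The moduli of the coordinates in the normalised basis; the same square roots
    turn \<open>hankel_gram\<close> into the square root of \<open>gram_sq\<close>.\<close>
  let ?\<alpha> = "\<lambda>k. sqrt (real (Suc k)) * cmod (a k)"
  have "(\<lambda>n. \<Sum>k\<in>A. \<Sum>l\<in>A. (a k * cnj (a l)) * (of_nat (Suc n) * (w (n + k) * cnj (w (n + l))))) sums ?G"
    by (intro sums_sum sums_mult hankel_gram_sums w)
  also have "(\<lambda>n. \<Sum>k\<in>A. \<Sum>l\<in>A. (a k * cnj (a l)) * (of_nat (Suc n) * (w (n + k) * cnj (w (n + l)))))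
      = (\<lambda>n. of_real (?q n))"
  proof
    fix n
    have "complex_of_real (?q n) = of_nat (Suc n) * ((\<Sum>k\<in>A. w (n + k) * a k) * cnj (\<Sum>l\<in>A. w (n + l) * a l))"
      by (simp only: of_real_mult complex_norm_square of_real_of_nat_eq)
    also have "\<dots> = (\<Sum>k\<in>A. \<Sum>l\<in>A. (a k * cnj (a l)) * (of_nat (Suc n) * (w (n + k) * cnj (w (n + l)))))"
      unfolding cnj_sum sum_product unfolding sum_distrib_left
      by (intro sum.cong refl) (simp only: complex_cnj_mult mult_ac)
    finally show "(\<Sum>k\<in>A. \<Sum>l\<in>A. (a k * cnj (a l)) * (of_nat (Suc n) * (w (n + k) * cnj (w (n + l)))))
      = complex_of_real (?q n)" by simp
  qed
  finally have "(\<lambda>n. complex_of_real (?q n)) sums ?G" .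
  then have q: "?q sums Re ?G"
    using sums_Re by fastforce
  have "(\<Sum>n<P. ?q n) \<le> Re ?G"
    unfolding sums_unique[OF q] by (intro sum_le_suminf sums_summable[OF q]) auto
  also have "\<dots> \<le> cmod ?G" by (rule complex_Re_le_cmod)
  also have "\<dots> \<le> (\<Sum>k\<in>A. \<Sum>l\<in>A. cmod (a k) * cmod (a l) * cmod (hankel_gram w k l))"
    by (intro order_trans[OF norm_sum] sum_mono) (simp add: norm_mult)
  also have "\<dots> = (\<Sum>(k,l)\<in>A \<times> A. (?\<alpha> k * ?\<alpha> l) * sqrt (gram_sq w k l))"
    unfolding sum.cartesian_product
  proof (intro sum.cong refl, clarify)
    fix k l
    have "sqrt (gram_sq w k l) = cmod (hankel_gram w k l) / (sqrt (real (Suc k)) * sqrt (real (Suc l)))"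
      by (simp add: gram_sq_def real_sqrt_divide real_sqrt_mult)
    then show "cmod (a k) * cmod (a l) * cmod (hankel_gram w k l) = (?\<alpha> k * ?\<alpha> l) * sqrt (gram_sq w k l)"
      by (simp add: field_simps)
  qed
  also have "\<dots> \<le> sqrt ((\<Sum>(k,l)\<in>A \<times> A. (?\<alpha> k * ?\<alpha> l)\<^sup>2) * (\<Sum>(k,l)\<in>A \<times> A. (sqrt (gram_sq w k l))\<^sup>2))"
    using Cauchy_Schwarz_ineq_sum[of "\<lambda>(k,l). ?\<alpha> k * ?\<alpha> l" "\<lambda>(k,l). sqrt (gram_sq w k l)" "A \<times> A"]
    by (intro real_le_rsqrt) (simp add: case_prod_unfold)
  also have "(\<Sum>(k,l)\<in>A \<times> A. (?\<alpha> k * ?\<alpha> l)\<^sup>2) = (\<Sum>k\<in>A. real (Suc k) * (cmod (a k))\<^sup>2)\<^sup>2"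
    unfolding power2_eq_square[of "\<Sum>k\<in>A. _ k"] sum_product sum.cartesian_product
    by (intro sum.cong refl) (auto simp: power_mult_distrib)
  also have "(\<Sum>(k,l)\<in>A \<times> A. (sqrt (gram_sq w k l))\<^sup>2) = (\<Sum>k\<in>A. \<Sum>l\<in>A. gram_sq w k l)"
    unfolding sum.cartesian_product by (intro sum.cong refl) auto
  finally show ?thesis
    by (simp add: real_sqrt_mult sum_nonneg mult.commute)
qed

text \<open>For a fixed number \<open>P\<close> of output coefficients the support is exhausted by
  \<open>{M..<N}\<close> with \<open>N\<close> growing, and then \<open>P\<close> grows. The choice
  \<open>M = 0\<close> yields boundedness of the operator, large \<open>M\<close> yields the
  smallness needed for compactness.\<close>

lemma hankel_sum_bound:
  assumes w: "weighted_summable w" and a: "weighted_summable a"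
    and e: "\<And>N. (\<Sum>k\<in>{M..<N}. \<Sum>l\<in>{M..<N}. gram_sq w k l) \<le> e\<^sup>2" and e0: "0 \<le> e"
    and z: "\<And>k. k < M \<Longrightarrow> a k = 0"
  shows "weighted_summable (hankel_sum w a)"
    and "(\<Sum>n. real (Suc n) * (cmod (hankel_sum w a n))\<^sup>2) \<le> e * (\<Sum>k. real (Suc k) * (cmod (a k))\<^sup>2)"
proof -
  let ?B = "e * (\<Sum>k. real (Suc k) * (cmod (a k))\<^sup>2)"
  have le: "(\<Sum>n<P. real (Suc n) * (cmod (hankel_sum w a n))\<^sup>2) \<le> ?B" for P
  proof (rule LIMSEQ_le_const2)
    have lim: "(\<lambda>N. \<Sum>k\<in>{M..<N}. w (n + k) * a k) \<longlonglongrightarrow> hankel_sum w a n" for n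
    proof -
      have "(\<lambda>N. \<Sum>k<N. w (n + k) * a k) \<longlonglongrightarrow> hankel_sum w a n"
        unfolding hankel_sum_def by (rule summable_LIMSEQ[OF hankel_sum_summable[OF w a]])
      also have "(\<lambda>N. \<Sum>k<N. w (n + k) * a k) = (\<lambda>N. \<Sum>k\<in>{M..<N}. w (n + k) * a k)"
        by (intro ext sum.mono_neutral_right) (auto simp: z)
      finally show ?thesis .
    qed
    show "(\<lambda>N. \<Sum>n<P. real (Suc n) * (cmod (\<Sum>k\<in>{M..<N}. w (n + k) * a k))\<^sup>2)
       \<longlonglongrightarrow> (\<Sum>n<P. real (Suc n) * (cmod (hankel_sum w a n))\<^sup>2)"
      by (intro tendsto_intros lim)
    have "(\<Sum>n<P. real (Suc n) * (cmod (\<Sum>k\<in>{M..<N}. w (n + k) * a k))\<^sup>2) \<le> ?B" for N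
    proof -
      have "(\<Sum>n<P. real (Suc n) * (cmod (\<Sum>k\<in>{M..<N}. w (n + k) * a k))\<^sup>2)
         \<le> sqrt (\<Sum>k\<in>{M..<N}. \<Sum>l\<in>{M..<N}. gram_sq w k l) * (\<Sum>k\<in>{M..<N}. real (Suc k) * (cmod (a k))\<^sup>2)"
        by (rule hankel_finite_sum_bound[OF w]) simp
      also have "\<dots> \<le> e * (\<Sum>k. real (Suc k) * (cmod (a k))\<^sup>2)"
        using e e0 by (intro mult_mono sum_le_suminf a real_le_lsqrt sum_nonneg) auto
      finally show ?thesis .
    qed
    then show "\<exists>N. \<forall>n\<ge>N. (\<Sum>i<P. real (Suc i) * (cmod (\<Sum>k = M..<n. w (i + k) * a k))\<^sup>2) \<le> ?B"
      by blast
  qed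
  show s: "weighted_summable (hankel_sum w a)"
    by (rule summableI_nonneg_bounded[OF _ le]) simp
  show "(\<Sum>n. real (Suc n) * (cmod (hankel_sum w a n))\<^sup>2) \<le> ?B"
    by (rule suminf_le_const[OF s le])
qed

section \<open>From bounded Gram sums to compactness\<close>

lemma hankel_coeff_eq: "hankel_coeff w f = hankel_sum w (taylor_coeff f)"
  by (simp add: fun_eq_iff hankel_coeff_def hankel_sum_def)

lemma hankel_sum_add:
  assumes "weighted_summable w" "weighted_summable a" "weighted_summable b"
  shows "hankel_sum w (\<lambda>k. a k + b k) = (\<lambda>n. hankel_sum w a n + hankel_sum w b n)"
  unfolding hankel_sum_def
  by (intro ext) (simp add: suminf_add hankel_sum_summable assms distrib_left del: of_nat_Suc)

lemma hankel_sum_cmult: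
  assumes "weighted_summable w" "weighted_summable a"
  shows "hankel_sum w (\<lambda>k. c * a k) = (\<lambda>n. c * hankel_sum w a n)"
  unfolding hankel_sum_def
  by (intro ext) (simp add: suminf_mult[symmetric] hankel_sum_summable assms mult.left_commute del: of_nat_Suc)

lemma power_series_fun_add:
  assumes "weighted_summable c" "weighted_summable d"
  shows "power_series_fun (\<lambda>n. c n + d n) = (\<lambda>z. power_series_fun c z + power_series_fun d z)"
  using weighted_converges_on_disk[OF assms(1)] weighted_converges_on_disk[OF assms(2)]
  by (auto simp: power_series_fun_def converges_on_disk_def fun_eq_iff suminf_add distrib_right)

lemma power_series_fun_cmult:
  assumes "weighted_summable d"
  shows "power_series_fun (\<lambda>n. c * d n) = (\<lambda>z. c * power_series_fun d z)"
  using weighted_converges_on_disk[OF assms]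
  by (auto simp: power_series_fun_def converges_on_disk_def fun_eq_iff suminf_mult mult.assoc)

text \<open>The block over \<open>{M..<N}\<close> is disjoint from the block over
  \<open>{..<M}\<close>, and both lie in the block over \<open>{..<N}\<close>. Hence it is at most
  an increment of the bounded increasing sequence \<open>G\<close>, which is Cauchy.\<close>

lemma gram_tail_small:
  assumes L: "\<And>K. (\<Sum>k<K. \<Sum>l<K. gram_sq w k l) \<le> L" and e: "0 < e"
  shows "\<exists>M. \<forall>N. (\<Sum>k\<in>{M..<N}. \<Sum>l\<in>{M..<N}. gram_sq w k l) \<le> e"
proof -
  define G where "G K = (\<Sum>k<K. \<Sum>l<K. gram_sq w k l)" for K
  have split: "(\<Sum>k\<in>{M..<N}. \<Sum>l\<in>{M..<N}. gram_sq w k l) + G M \<le> G N" if "M \<le> N" for M N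
  proof -
    have "(\<Sum>k\<in>{M..<N}. \<Sum>l\<in>{M..<N}. gram_sq w k l) + G M
        = sum (\<lambda>(k, l). gram_sq w k l) ({M..<N} \<times> {M..<N} \<union> {..<M} \<times> {..<M})"
      unfolding G_def sum.cartesian_product by (rule sum.union_disjoint[symmetric]) auto
    also have "\<dots> \<le> sum (\<lambda>(k, l). gram_sq w k l) ({..<N} \<times> {..<N})"
      using that by (intro sum_mono2) auto
    finally show ?thesis unfolding G_def sum.cartesian_product .
  qed
  have "incseq G"
  proof (rule incseq_SucI)
    fix n
    have "0 \<le> (\<Sum>k\<in>{n..<Suc n}. \<Sum>l\<in>{n..<Suc n}. gram_sq w k l)" by (intro sum_nonneg) auto
    then show "G n \<le> G (Suc n)" using split[of n "Suc n"] by linarith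
  qed
  moreover have "\<forall>i. G i \<le> L" unfolding G_def using L by blast
  ultimately obtain l where "G \<longlonglongrightarrow> l" by (rule incseq_convergent)
  then have "Cauchy G" by (rule LIMSEQ_imp_Cauchy)
  then obtain M where M: "\<And>m n. m \<ge> M \<Longrightarrow> n \<ge> M \<Longrightarrow> dist (G m) (G n) < e"
    using e unfolding Cauchy_def by blast
  have "(\<Sum>k\<in>{M..<N}. \<Sum>l\<in>{M..<N}. gram_sq w k l) \<le> e" for N
  proof (cases "M \<le> N")
    case True
    then show ?thesis using M[of N M] split[OF True] by (simp add: dist_real_def)
  qed (use e in auto)
  then show ?thesis by blast
qed

text \<open>A diagonal argument: every coordinate is bounded, so a convergent subsequence can be
  extracted for one coordinate after the other.\<close>

lemma pointwise_convergent_subsequence: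
  fixes a :: "nat \<Rightarrow> nat \<Rightarrow> 'a :: heine_borel"
  assumes B: "\<And>k. bounded (range (\<lambda>i. a i k))"
  obtains r \<alpha> where "strict_mono r" "\<And>k. (\<lambda>i. a (r i) k) \<longlonglongrightarrow> \<alpha> k"
proof -
  interpret subseqs "\<lambda>k s. convergent (\<lambda>i. a (s i) k)"
  proof
    fix k and s :: "nat \<Rightarrow> nat"
    assume "strict_mono s"
    have "bounded (range (\<lambda>i. a (s i) k))"
      by (rule bounded_subset[OF B[of k]]) auto
    from bounded_imp_convergent_subsequence[OF this]
    show "\<exists>r'. strict_mono r' \<and> convergent (\<lambda>i. a ((s \<circ> r') i) k)"
      by (auto simp: convergent_def o_def)
  qed
  have "convergent (\<lambda>i. a (diagseq i) k)" for k
  proof -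
    \<comment> \<open>Only from index \<open>Suc k\<close> on is the diagonal sequence a subsequence
      of the extraction for coordinate \<open>k\<close>; the initial segment is discarded
      afterwards.\<close>
    have "convergent (\<lambda>i. a ((diagseq \<circ> ((+) (Suc k))) i) k)"
      by (rule diagseq_holds) (auto simp: convergent_def o_def intro: LIMSEQ_subseq_LIMSEQ[unfolded o_def])
    then have "convergent (\<lambda>i. a (diagseq (i + Suc k)) k)"
      by (simp add: o_def add.commute)
    then show ?thesis by (rule convergent_ignore_initial_segment[THEN iffD1])
  qed
  then have "(\<lambda>i. a (diagseq i) k) \<longlonglongrightarrow> lim (\<lambda>i. a (diagseq i) k)" for k
    by (simp add: convergent_LIMSEQ_iff)
  then show ?thesis by (rule that[OF subseq_diagseq])
qed

text \<open>The head of \<open>a\<close> is charged with the full bound \<open>L\<close>, the tail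
  with the small bound \<open>e\<close>. Along a bounded sequence that tends to 0 coefficientwise,
  both contributions can then be made small. The factor 2 comes from squaring a sum of two
  terms.\<close>

lemma hankel_sum_bound_split:
  assumes w: "weighted_summable w" and a: "weighted_summable a"
    and L: "\<And>K. (\<Sum>k<K. \<Sum>l<K. gram_sq w k l) \<le> L\<^sup>2" "0 \<le> L"
    and e: "\<And>N. (\<Sum>k\<in>{M..<N}. \<Sum>l\<in>{M..<N}. gram_sq w k l) \<le> e\<^sup>2" "0 \<le> e"
  shows "(\<Sum>n. real (Suc n) * (cmod (hankel_sum w a n))\<^sup>2)
    \<le> 2 * (L * (\<Sum>k<M. real (Suc k) * (cmod (a k))\<^sup>2) + e * (\<Sum>k. real (Suc k) * (cmod (a k))\<^sup>2))"
proof -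
  let ?W = "\<lambda>a n. real (Suc n) * (cmod (a n))\<^sup>2"
  define b where "b k = (if k < M then a k else 0)" for k
  define c where "c k = (if k < M then 0 else a k)" for k
  have sb: "?W b sums (\<Sum>k<M. ?W a k)"
    using sums_If_finite_set[of "{..<M}" "?W a"]
    by (rule sums_cong[THEN iffD1, rotated]) (auto simp: b_def)
  then have bs: "weighted_summable b" by (rule sums_summable)
  have cle: "?W c n \<le> ?W a n" for n by (auto simp: c_def)
  have cs: "weighted_summable c"
    by (rule summable_comparison_test'[OF a, of 0]) (use cle in auto)
  have L': "(\<Sum>k\<in>{0..<K}. \<Sum>l\<in>{0..<K}. gram_sq w k l) \<le> L\<^sup>2" for K
    using L(1)[of K] by (simp add: atLeast0LessThan)
  have Cz: "\<And>k. k < M \<Longrightarrow> c k = 0" by (simp add: c_def)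
  have C: "weighted_summable (hankel_sum w c)"
    "(\<Sum>n. ?W (hankel_sum w c) n) \<le> e * (\<Sum>k. ?W c k)"
    by (rule hankel_sum_bound[OF w cs e Cz], assumption)+
  have B1: "weighted_summable (hankel_sum w b)"
    and B2: "(\<Sum>n. ?W (hankel_sum w b) n) \<le> L * (\<Sum>k<M. ?W a k)"
    using hankel_sum_bound[OF w bs L' L(2)] sums_unique[OF sb] by auto
  have C2: "(\<Sum>n. ?W (hankel_sum w c) n) \<le> e * (\<Sum>k. ?W a k)"
    by (rule order_trans[OF C(2)]) (intro mult_left_mono suminf_le cle cs a e(2))
  have "a = (\<lambda>k. b k + c k)" by (auto simp: b_def c_def)
  then have h: "hankel_sum w a = (\<lambda>n. hankel_sum w b n + hankel_sum w c n)"
    using hankel_sum_add[OF w bs cs] by simp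
  have le: "?W (hankel_sum w a) n \<le> 2 * (?W (hankel_sum w b) n + ?W (hankel_sum w c) n)" for n
  proof -
    have "(cmod (hankel_sum w b n + hankel_sum w c n))\<^sup>2 
        \<le> 2 * ((cmod (hankel_sum w b n))\<^sup>2 + (cmod (hankel_sum w c n))\<^sup>2)"
      using norm_add_sq_le[of 1 "hankel_sum w b n" "hankel_sum w c n"] by simp
    from mult_left_mono[OF this, of "real (Suc n)"] show ?thesis
      unfolding h by (simp add: algebra_simps)
  qed
  have S: "summable (\<lambda>n. 2 * (?W (hankel_sum w b) n + ?W (hankel_sum w c) n))"
    by (intro summable_mult summable_add B1 C(1))
  have "(\<Sum>n. ?W (hankel_sum w a) n) \<le> (\<Sum>n. 2 * (?W (hankel_sum w b) n + ?W (hankel_sum w c) n))"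
    by (rule suminf_le[OF le _ S], rule summable_comparison_test'[OF S, of 0]) (use le in auto)
  also have "\<dots> = 2 * ((\<Sum>n. ?W (hankel_sum w b) n) + (\<Sum>n. ?W (hankel_sum w c) n))"
    unfolding suminf_add[OF B1 C(1)] by (rule suminf_mult[OF summable_add[OF B1 C(1)]])
  also have "\<dots> \<le> 2 * (L * (\<Sum>k<M. ?W a k) + e * (\<Sum>k. ?W a k))"
    by (intro mult_left_mono add_mono B2 C2) simp
  finally show ?thesis .
qed

text \<open>The unit ball is sequentially compact for coefficientwise convergence, and the bound for
  head and tail makes the operator continuous from this convergence on the ball to the norm. So the
  image of the ball is already compact.\<close>

theorem hankel_compact_if_gram_bounded:
  assumes w: "weighted_summable w"
    and L: "\<And>K. (\<Sum>k<K. \<Sum>l<K. gram_sq w k l) \<le> L"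
  shows "hankel_compact_on_dirichlet w"
proof -
  let ?T = "hankel_operator w" and ?W = "\<lambda>a n. real (Suc n) * (cmod (a n))\<^sup>2"
  define L' where "L' = sqrt L"
  have "0 \<le> L" using L[of 0] by simp
  then have L': "(\<Sum>k<K. \<Sum>l<K. gram_sq w k l) \<le> L'\<^sup>2" "0 \<le> L'" for K
    using L by (auto simp: L'_def)
  have t: "weighted_summable (taylor_coeff f)" if "f \<in> dirichlet_space" for f
    by (rule dirichlet_space_weighted_sum(1)[OF that])
  have H: "weighted_summable (hankel_sum w a)" if "weighted_summable a" for a
    using hankel_sum_bound(1)[OF w that, of 0 L'] L' by (simp add: atLeast0LessThan)
  have T: "?T f = power_series_fun (hankel_sum w (taylor_coeff f))" for f
    by (simp add: hankel_operator_def hankel_coeff_eq)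
  have TD: "?T f \<in> dirichlet_space" if "f \<in> dirichlet_space" for f
    unfolding T by (intro power_series_fun_dirichlet H t that)
  have add: "?T (\<lambda>z. f z + g z) = (\<lambda>z. ?T f z + ?T g z)" if "f \<in> dirichlet_space" "g \<in> dirichlet_space" for f g
    unfolding T taylor_coeff_add[OF that] hankel_sum_add[OF w t[OF that(1)] t[OF that(2)]]
    by (intro power_series_fun_add H t that)
  have cmult: "?T (\<lambda>z. c * f z) = (\<lambda>z. c * ?T f z)" if "f \<in> dirichlet_space" for c f
    unfolding T taylor_coeff_cmult[OF that] hankel_sum_cmult[OF w t[OF that]]
    by (intro power_series_fun_cmult H t that)
  have diff: "?T (\<lambda>z. f z - g z) = (\<lambda>z. ?T f z - ?T g z)" if "f \<in> dirichlet_space" "g \<in> dirichlet_space" for f g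
    using add[OF that(1) dirichlet_space_cmult(1)[OF that(2), of "-1"]] cmult[OF that(2), of "-1"] by simp
  have norm_le: "(dirichlet_norm (?T f))\<^sup>2 \<le> (\<Sum>n. ?W (hankel_sum w (taylor_coeff f)) n)"
    if f: "f \<in> dirichlet_space" for f
    using dirichlet_space_weighted_sum(3)[OF TD[OF f]]
    unfolding T taylor_coeff_power_series_fun[OF H[OF t[OF f]]] .
  define B where "B = {f \<in> dirichlet_space. dirichlet_norm f \<le> 1}"
  have "compactin dirichlet.mtopology (?T ` B)"
    unfolding dirichlet.compactin_sequentially
  proof (intro conjI allI impI)
    show "?T ` B \<subseteq> dirichlet_space" using TD by (auto simp: B_def)
    fix \<sigma> :: "nat \<Rightarrow> complex \<Rightarrow> complex"
    assume "range \<sigma> \<subseteq> ?T ` B"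
    then have "\<forall>i. \<exists>f\<in>B. \<sigma> i = ?T f" by auto
    then obtain \<phi> where \<phi>: "\<And>i. \<phi> i \<in> B" "\<And>i. \<sigma> i = ?T (\<phi> i)" by metis
    then have \<phi>D: "\<phi> i \<in> dirichlet_space" and \<phi>1: "dirichlet_norm (\<phi> i) \<le> 1" for i
      by (auto simp: B_def)
    define a where "a i = taylor_coeff (\<phi> i)" for i
    have as: "(\<lambda>n. real (max 1 n) * (cmod (a i n))\<^sup>2) sums (dirichlet_norm (\<phi> i))\<^sup>2" for i
      unfolding a_def by (rule dirichlet_norm_sums[OF \<phi>D])
    have psum: "(\<Sum>n<N. real (max 1 n) * (cmod (a i n))\<^sup>2) \<le> 1" for i N
    proof -
      have "(\<Sum>n<N. real (max 1 n) * (cmod (a i n))\<^sup>2) \<le> (dirichlet_norm (\<phi> i))\<^sup>2"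
        unfolding sums_unique[OF as] by (intro sum_le_suminf sums_summable[OF as]) auto
      also have "\<dots> \<le> 1" using \<phi>1[of i] by (simp add: power_le_one)
      finally show ?thesis .
    qed
    have "cmod (a i k) \<le> 1" for i k
    proof -
      have "1 * (cmod (a i k))\<^sup>2 \<le> real (max 1 k) * (cmod (a i k))\<^sup>2"
        by (intro mult_right_mono) auto
      also have "\<dots> \<le> (\<Sum>n<Suc k. real (max 1 n) * (cmod (a i n))\<^sup>2)"
        by (rule member_le_sum) auto
      also have "\<dots> \<le> 1" by (rule psum)
      finally show ?thesis by (simp add: power_le_one_iff)
    qed
    then have "bounded (range (\<lambda>i. a i k))" for k
      by (auto simp: bounded_iff)
    from pointwise_convergent_subsequence[of a, OF this]
    obtain r \<alpha> where r: "strict_mono r" and \<alpha>: "\<And>k. (\<lambda>i. a (r i) k) \<longlonglongrightarrow> \<alpha> k" by blast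
    \<comment> \<open>The exact weight \<open>max 1 n\<close> is used here so that the limit lies in
      the same unit ball; the weight \<open>n + 1\<close> would lose a factor 2.\<close>
    have \<alpha>sum: "(\<Sum>n<N. real (max 1 n) * (cmod (\<alpha> n))\<^sup>2) \<le> 1" for N
    proof (rule LIMSEQ_le_const2)
      show "(\<lambda>i. \<Sum>n<N. real (max 1 n) * (cmod (a (r i) n))\<^sup>2) \<longlonglongrightarrow> (\<Sum>n<N. real (max 1 n) * (cmod (\<alpha> n))\<^sup>2)"
        by (intro tendsto_intros \<alpha>)
    qed (use psum in auto)
    have \<alpha>s: "summable (\<lambda>n. real (max 1 n) * (cmod (\<alpha> n))\<^sup>2)"
      by (rule summableI_nonneg_bounded[OF _ \<alpha>sum]) simp
    have \<alpha>w: "weighted_summable \<alpha>"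
      by (rule summable_comparison_test'[OF summable_mult[OF \<alpha>s, of 2], of 0])
         (auto simp: mult.assoc[symmetric] intro!: mult_right_mono)
    define f where "f = power_series_fun \<alpha>"
    have fD: "f \<in> dirichlet_space" and ft: "taylor_coeff f = \<alpha>"
      unfolding f_def by (rule power_series_fun_dirichlet[OF \<alpha>w], rule taylor_coeff_power_series_fun[OF \<alpha>w])
    have "(dirichlet_norm f)\<^sup>2 \<le> 1"
      using suminf_le_const[OF \<alpha>s \<alpha>sum] sums_unique[OF dirichlet_norm_sums[OF fD]] ft by simp
    then have f1: "dirichlet_norm f \<le> 1"
      by (simp add: power_le_one_iff abs_square_le_1)
    have fB: "f \<in> B" using fD f1 by (simp add: B_def)
    have gD: "(\<lambda>z. \<phi> i z - f z) \<in> dirichlet_space" for i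
      by (intro dirichlet_space_diff \<phi>D fD)
    have gt: "taylor_coeff (\<lambda>z. \<phi> i z - f z) = (\<lambda>n. a i n - \<alpha> n)" for i
      unfolding taylor_coeff_diff[OF \<phi>D fD] ft a_def ..
    have gs: "weighted_summable (\<lambda>n. a i n - \<alpha> n)" for i
      using t[OF gD[of i]] unfolding gt .
    \<comment> \<open>Two points of the unit ball have distance at most 2; its square 4 is doubled
      by the change of weight.\<close>
    have g8: "(\<Sum>n. ?W (\<lambda>n. a i n - \<alpha> n) n) \<le> 8" for i
    proof -
      have "dirichlet_norm (\<lambda>z. \<phi> i z - f z) \<le> dirichlet_norm (\<phi> i) + dirichlet_norm f"
        using dirichlet_norm_triangle[OF \<phi>D dirichlet_space_cmult(1)[OF fD, of "-1"], of i]
          dirichlet_space_cmult(2)[OF fD, of "-1"] by simp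
      also have "\<dots> \<le> 2" using f1 \<phi>1[of i] by simp
      finally have "(dirichlet_norm (\<lambda>z. \<phi> i z - f z))\<^sup>2 \<le> 2\<^sup>2"
        by (intro power_mono) auto
      then show ?thesis
        using dirichlet_space_weighted_sum(2)[OF gD[of i]] unfolding gt by simp
    qed
    have dist: "(dirichlet_dist (?T (\<phi> i)) (?T f))\<^sup>2 \<le> (\<Sum>n. ?W (hankel_sum w (\<lambda>n. a i n - \<alpha> n)) n)" for i
      using norm_le[OF gD[of i]] TD[OF \<phi>D] TD[OF fD]
      unfolding gt diff[OF \<phi>D fD] by (simp add: dirichlet_dist_def)
    have "(\<lambda>i. (dirichlet_dist (?T (\<phi> (r i))) (?T f))\<^sup>2) \<longlonglongrightarrow> 0"
    proof (rule LIMSEQ_I)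
      fix \<epsilon> :: real assume \<epsilon>: "0 < \<epsilon>"
      \<comment> \<open>With the bound 8 the tail contributes at most \<open>\<epsilon> / 4\<close>;
        the head is brought below \<open>\<epsilon> / 4\<close>, and the factor 2 of the splitting
        gives \<open>\<epsilon>\<close>.\<close>
      obtain M where M: "\<And>N. (\<Sum>k\<in>{M..<N}. \<Sum>l\<in>{M..<N}. gram_sq w k l) \<le> (\<epsilon> / 32)\<^sup>2"
        using gram_tail_small[OF L, of "(\<epsilon> / 32)\<^sup>2"] \<epsilon> by auto
      have "(\<lambda>i. L' * (\<Sum>k<M. ?W (\<lambda>n. a (r i) n - \<alpha> n) k)) \<longlonglongrightarrow> L' * (\<Sum>k<M. ?W (\<lambda>n. \<alpha> n - \<alpha> n) k)"
        by (intro tendsto_intros \<alpha>)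
      then have "(\<lambda>i. L' * (\<Sum>k<M. ?W (\<lambda>n. a (r i) n - \<alpha> n) k)) \<longlonglongrightarrow> 0" by simp
      then have "\<forall>\<^sub>F i in sequentially. L' * (\<Sum>k<M. ?W (\<lambda>n. a (r i) n - \<alpha> n) k) < \<epsilon> / 4"
        using \<epsilon> by (intro order_tendstoD) auto
      then have "\<forall>\<^sub>F i in sequentially. (dirichlet_dist (?T (\<phi> (r i))) (?T f))\<^sup>2 < \<epsilon>"
      proof eventually_elim
        case (elim i)
        have "(dirichlet_dist (?T (\<phi> (r i))) (?T f))\<^sup>2
           \<le> 2 * (L' * (\<Sum>k<M. ?W (\<lambda>n. a (r i) n - \<alpha> n) k) + \<epsilon> / 32 * (\<Sum>k. ?W (\<lambda>n. a (r i) n - \<alpha> n) k))"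
          using \<epsilon> by (intro order_trans[OF dist hankel_sum_bound_split[OF w gs L' M]]) auto
        moreover have "\<epsilon> / 32 * (\<Sum>k. ?W (\<lambda>n. a (r i) n - \<alpha> n) k) \<le> \<epsilon> / 32 * 8"
          using \<epsilon> by (intro mult_left_mono g8) auto
        moreover have "d < \<epsilon>" if "d \<le> 2 * (x + y)" "y \<le> \<epsilon> / 32 * 8" "x < \<epsilon> / 4" for d x y
          using that by simp
        ultimately show ?case using elim by blast
      qed
      then show "\<exists>no. \<forall>n\<ge>no. norm ((dirichlet_dist (?T (\<phi> (r n))) (?T f))\<^sup>2 - 0) < \<epsilon>"
        by (simp add: eventually_sequentially)
    qed
    then have "(\<lambda>i. sqrt ((dirichlet_dist (?T (\<phi> (r i))) (?T f))\<^sup>2)) \<longlonglongrightarrow> sqrt 0"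
      by (rule tendsto_real_sqrt)
    then have "(\<lambda>i. dirichlet_dist (?T (\<phi> (r i))) (?T f)) \<longlonglongrightarrow> 0"
      by simp
    then have "limitin dirichlet.mtopology (\<sigma> \<circ> r) (?T f) sequentially"
      unfolding dirichlet.limitin_metric_dist_null using TD[OF fD] TD[OF \<phi>D] by (simp add: \<phi>(2))
    then show "\<exists>l r. l \<in> ?T ` B \<and> strict_mono r \<and> limitin dirichlet.mtopology (\<sigma> \<circ> r) l sequentially"
      using fB r by blast
  qed
  \<comment> \<open>A compact set in a Hausdorff space is closed.\<close>
  moreover from this have "dirichlet.mtopology closure_of (?T ` B) = ?T ` B"
    by (intro closure_of_closedin compactin_imp_closedin dirichlet.Hausdorff_space_mtopology)
  ultimately have cpt: "compactin dirichlet.mtopology (dirichlet.mtopology closure_of (?T ` B))"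
    by simp
  have "hankel_well_defined w f" if "f \<in> dirichlet_space" for f
    unfolding hankel_well_defined_def hankel_coeff_eq
    using hankel_sum_summable[OF w t[OF that]] weighted_converges_on_disk[OF H[OF t[OF that]]] by simp
  moreover have "dirichlet_compact_operator ?T"
    unfolding dirichlet_compact_operator_def using TD add cmult cpt by (auto simp: B_def)
  ultimately show ?thesis
    unfolding hankel_compact_on_dirichlet_def by simp
qed

section \<open>Random symbols\<close>

lemma abs_prod4_le: "\<bar>a * b * c * d\<bar> \<le> (a ^ 4 + b ^ 4 + c ^ 4 + d ^ 4 :: real)"
proof -
  have *: "\<bar>x * y\<bar> \<le> x\<^sup>2 + y\<^sup>2" for x y :: real
  proof -
    have "\<bar>x * y\<bar> \<le> (\<bar>x\<bar>\<^sup>2 + \<bar>y\<bar>\<^sup>2) / 2"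
      unfolding abs_mult by (rule mult_le_mean_squares)
    also have "\<dots> \<le> x\<^sup>2 + y\<^sup>2" by simp
    finally show ?thesis .
  qed
  have **: "(x * y)\<^sup>2 \<le> (x ^ 4 + y ^ 4) / 2" for x y :: real
    using mult_le_mean_squares[of "x\<^sup>2" "y\<^sup>2"] by (simp add: power_mult_distrib)
  have "\<bar>a * b * c * d\<bar> \<le> (a * b)\<^sup>2 + (c * d)\<^sup>2"
    using *[of "a * b" "c * d"] by (simp add: mult.assoc)
  also have "\<dots> \<le> (a ^ 4 + b ^ 4) / 2 + (c ^ 4 + d ^ 4) / 2"
    by (intro add_mono **)
  also have "\<dots> \<le> a ^ 4 + b ^ 4 + c ^ 4 + d ^ 4"
    by (simp add: field_simps)
  finally show ?thesis .
qed

lemma norm_sum_of_real_square: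
  fixes d :: "'i \<Rightarrow> complex" and y :: "'i \<Rightarrow> real"
  shows "(cmod (\<Sum>n\<in>A. d n * of_real (y n)))\<^sup>2 = (\<Sum>n\<in>A. \<Sum>m\<in>A. Re (d n * cnj (d m)) * (y n * y m))"
proof -
  have "complex_of_real ((cmod (\<Sum>n\<in>A. d n * of_real (y n)))\<^sup>2)
     = (\<Sum>n\<in>A. \<Sum>m\<in>A. (d n * of_real (y n)) * cnj (d m * of_real (y m)))"
    unfolding complex_norm_square cnj_sum sum_product ..
  then have "Re (complex_of_real ((cmod (\<Sum>n\<in>A. d n * of_real (y n)))\<^sup>2))
     = (\<Sum>n\<in>A. \<Sum>m\<in>A. Re ((d n * of_real (y n)) * cnj (d m * of_real (y m))))"
    by simp
  also have "\<dots> = (\<Sum>n\<in>A. \<Sum>m\<in>A. Re (d n * cnj (d m)) * (y n * y m))"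
    by (intro sum.cong refl) (simp add: algebra_simps)
  finally show ?thesis by simp
qed

text \<open>Once the weight depends on \<open>k\<close> alone, the sum over \<open>l\<close> is at
  most \<open>suminf c\<close>, then so is the sum over \<open>n\<close>, and only the inverse
  squares remain. The half with weight in \<open>l\<close> equals the other one by exchanging
  \<open>k\<close> and \<open>l\<close>.\<close>

lemma convolution_square_sum_bound:
  fixes c :: "nat \<Rightarrow> real"
  assumes c0: "\<And>n. 0 \<le> c n" and c: "summable c"
  shows "(\<Sum>k<N. \<Sum>l<N. \<Sum>n<N. c (n + k) * c (n + l) / (real (Suc k) * real (Suc l)))
     \<le> (suminf c)\<^sup>2 * (\<Sum>k<N. 1 / (real (Suc k))\<^sup>2)"
proof -
  let ?p = "\<lambda>k. 1 / (real (Suc k))\<^sup>2"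
  let ?T = "\<Sum>k<N. \<Sum>l<N. \<Sum>n<N. c (n + k) * c (n + l) * ?p k"
  have part: "(\<Sum>n<N. c (n + k)) \<le> suminf c" for k
  proof -
    have "(\<Sum>n<N. c (n + k)) = sum c ((\<lambda>n. n + k) ` {..<N})"
      by (subst sum.reindex) auto
    also have "\<dots> \<le> suminf c" by (intro sum_le_suminf c c0) auto
    finally show ?thesis .
  qed
  have T: "?T \<le> (suminf c)\<^sup>2 * (\<Sum>k<N. ?p k)"
  proof -
    have "?T = (\<Sum>k<N. ?p k * (\<Sum>n<N. c (n + k) * (\<Sum>l<N. c (l + n))))"
      by (subst sum.swap[of _ "{..<N}" "{..<N}" for f], intro sum.cong refl)
         (simp add: sum_distrib_left mult_ac add.commute)
    also have "\<dots> \<le> (\<Sum>k<N. ?p k * (\<Sum>n<N. c (n + k) * suminf c))"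
      by (intro sum_mono mult_left_mono part c0) auto
    also have "\<dots> = (\<Sum>k<N. ?p k * ((\<Sum>n<N. c (n + k)) * suminf c))"
      by (simp add: sum_distrib_right)
    also have "\<dots> \<le> (\<Sum>k<N. ?p k * (suminf c * suminf c))"
      by (intro sum_mono mult_left_mono mult_right_mono part suminf_nonneg c c0) auto
    also have "\<dots> = (suminf c)\<^sup>2 * (\<Sum>k<N. ?p k)"
      by (simp add: sum_distrib_left power2_eq_square mult_ac)
    finally show ?thesis .
  qed
  have "(\<Sum>k<N. \<Sum>l<N. \<Sum>n<N. c (n + k) * c (n + l) / (real (Suc k) * real (Suc l)))
      \<le> (\<Sum>k<N. \<Sum>l<N. \<Sum>n<N. (c (n + k) * c (n + l) * ?p k + c (n + l) * c (n + k) * ?p l) / 2)"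
  proof (intro sum_mono)
    fix k l n
    have "c (n + k) * c (n + l) * ((1 / real (Suc k)) * (1 / real (Suc l)))
        \<le> c (n + k) * c (n + l) * (((1 / real (Suc k))\<^sup>2 + (1 / real (Suc l))\<^sup>2) / 2)"
      by (intro mult_left_mono mult_le_mean_squares mult_nonneg_nonneg c0)
    also have "\<dots> = (c (n + k) * c (n + l) * ?p k + c (n + l) * c (n + k) * ?p l) / 2"
      by (simp add: power_one_over algebra_simps add_divide_distrib del: of_nat_Suc)
    finally show "c (n + k) * c (n + l) / (real (Suc k) * real (Suc l))
      \<le> (c (n + k) * c (n + l) * ?p k + c (n + l) * c (n + k) * ?p l) / 2"
      by simp
  qed
  also have "\<dots> = (?T + (\<Sum>k<N. \<Sum>l<N. \<Sum>n<N. c (n + l) * c (n + k) * ?p l)) / 2"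
    by (simp only: sum.distrib sum_divide_distrib[symmetric])
  also have "(\<Sum>k<N. \<Sum>l<N. \<Sum>n<N. c (n + l) * c (n + k) * ?p l) = ?T"
    by (rule sum.swap)
  finally show ?thesis using T by simp
qed

lemma inverse_squares_partial_sum: "(\<Sum>k<N. 1 / (real (Suc k))\<^sup>2) \<le> pi\<^sup>2 / 6"
proof -
  have s: "(\<lambda>n. 1 / (real (Suc n))\<^sup>2) sums (pi\<^sup>2 / 6)"
    using inverse_squares_sums by (simp add: add.commute)
  show ?thesis
    unfolding sums_unique[OF s] by (intro sum_le_suminf sums_summable[OF s]) auto
qed

text \<open>Without any cancellation \<open>hankel_gram w k k\<close> is bounded uniformly in
  \<open>k\<close>, because \<open>n + 1 \<le> n + k + 1\<close> lets the shifted sum be absorbed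
  into the full one. The two weights in \<open>gram_sq\<close> then supply a convergent series of
  inverse squares.\<close>

lemma gram_sq_diagonal_bound:
  assumes w: "weighted_summable w"
  shows "(\<Sum>k<K. gram_sq w k k) \<le> (\<Sum>n. real (Suc n) * (cmod (w n))\<^sup>2)\<^sup>2 * (pi\<^sup>2 / 6)"
proof -
  let ?f = "\<lambda>n. real (Suc n) * (cmod (w n))\<^sup>2"
  have "cmod (hankel_gram w k k) \<le> suminf ?f" for k
  proof -
    have n: "norm (of_nat (Suc n) * (w (n + k) * cnj (w (n + k)))) = real (Suc n) * (cmod (w (n + k)))\<^sup>2" for n
      by (simp add: norm_mult power2_eq_square del: of_nat_Suc)
    have "cmod (hankel_gram w k k) \<le> (\<Sum>n. real (Suc n) * (cmod (w (n + k)))\<^sup>2)"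
      unfolding hankel_gram_def n[symmetric]
      by (rule summable_norm) (simp only: n weighted_summable_shift[OF w])
    also have "\<dots> \<le> (\<Sum>n. ?f (n + k))"
      by (intro suminf_le weighted_summable_shift w)
         (auto simp del: of_nat_Suc intro!: mult_right_mono simp: summable_iff_shift[of ?f] w)
    also have "\<dots> \<le> suminf ?f"
      unfolding suminf_split_initial_segment[OF w, of k] by (simp add: sum_nonneg)
    finally show ?thesis .
  qed
  then have "gram_sq w k k \<le> (suminf ?f)\<^sup>2 * (1 / (real (Suc k))\<^sup>2)" for k
    unfolding gram_sq_def power2_eq_square[of "real (Suc k)"]
    by (auto simp del: of_nat_Suc intro!: divide_right_mono power_mono)
  then have "(\<Sum>k<K. gram_sq w k k) \<le> (\<Sum>k<K. (suminf ?f)\<^sup>2 * (1 / (real (Suc k))\<^sup>2))"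
    by (rule sum_mono)
  also have "\<dots> \<le> (suminf ?f)\<^sup>2 * (pi\<^sup>2 / 6)"
    unfolding sum_distrib_left[symmetric] by (intro mult_left_mono inverse_squares_partial_sum) auto
  finally show ?thesis .
qed

text \<open>Truncating the series of \<open>hankel_gram\<close> makes every random entry a finite
  combination, whose moments can be computed termwise.\<close>

definition partial_gram :: "(nat \<Rightarrow> complex) \<Rightarrow> nat \<Rightarrow> nat \<Rightarrow> nat \<Rightarrow> complex" where
  "partial_gram w N k l = (\<Sum>n<N. of_nat (Suc n) * (w (n + k) * cnj (w (n + l))))"

text \<open>\<open>N\<close> truncates the series of each entry and \<open>K\<close> the matrix.
  They are separate so that \<open>N\<close> can tend to infinity for fixed \<open>K\<close>, while
  the moment bound is taken at \<open>K = N\<close>.\<close>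

definition offdiag_gram_sum :: "(nat \<Rightarrow> complex) \<Rightarrow> nat \<Rightarrow> nat \<Rightarrow> real" where
  "offdiag_gram_sum w N K = (\<Sum>k<K. \<Sum>l<K. if k = l then 0
     else (cmod (partial_gram w N k l))\<^sup>2 / (real (Suc k) * real (Suc l)))"

lemma gram_sq_sum_bounded:
  assumes w: "weighted_summable w"
    and fin: "liminf (\<lambda>N. ennreal (offdiag_gram_sum w N N)) \<noteq> \<infinity>"
  shows "\<exists>L. \<forall>K. (\<Sum>k<K. \<Sum>l<K. gram_sq w k l) \<le> L"
proof -
  let ?\<Lambda> = "liminf (\<lambda>N. ennreal (offdiag_gram_sum w N N))"
  have "(\<Sum>k<K. \<Sum>l<K. gram_sq w k l)
      \<le> enn2real ?\<Lambda> + (\<Sum>n. real (Suc n) * (cmod (w n))\<^sup>2)\<^sup>2 * (pi\<^sup>2 / 6)" for K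
  proof -
    let ?h = "\<Sum>k<K. \<Sum>l<K. if k = l then 0 else gram_sq w k l"
    have lim: "(\<lambda>N. partial_gram w N k l) \<longlonglongrightarrow> hankel_gram w k l" for k l
      using hankel_gram_sums[OF w] unfolding sums_def partial_gram_def .
    have "(\<lambda>N. offdiag_gram_sum w N K) \<longlonglongrightarrow> ?h"
      unfolding offdiag_gram_sum_def
    proof (intro tendsto_sum)
      fix k l
      show "(\<lambda>N. if k = l then 0 else (cmod (partial_gram w N k l))\<^sup>2 / (real (Suc k) * real (Suc l)))
        \<longlonglongrightarrow> (if k = l then 0 else gram_sq w k l)"
        by (cases "k = l") (auto simp: gram_sq_def simp del: of_nat_Suc intro!: tendsto_intros lim)
    qed
    then have "liminf (\<lambda>N. ennreal (offdiag_gram_sum w N K)) = ennreal ?h"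
      by (intro lim_imp_Liminf tendsto_ennrealI) auto
    moreover have "liminf (\<lambda>N. ennreal (offdiag_gram_sum w N K)) \<le> ?\<Lambda>"
    proof (rule Liminf_mono)
      have "offdiag_gram_sum w N K \<le> offdiag_gram_sum w N N" if "K \<le> N" for N
        unfolding offdiag_gram_sum_def sum.cartesian_product
        using that by (intro sum_mono2) (auto split: if_splits)
      then show "\<forall>\<^sub>F N in sequentially. ennreal (offdiag_gram_sum w N K) \<le> ennreal (offdiag_gram_sum w N N)"
        by (intro eventually_sequentiallyI[of K] ennreal_leI)
    qed
    ultimately have "ennreal ?h \<le> ?\<Lambda>" by simp
    then have "enn2real (ennreal ?h) \<le> enn2real ?\<Lambda>"
      using fin by (intro enn2real_mono) (auto simp: less_top)
    then have h: "?h \<le> enn2real ?\<Lambda>"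
      by (simp add: sum_nonneg)
    have "(\<Sum>k<K. \<Sum>l<K. gram_sq w k l)
        = (\<Sum>k<K. \<Sum>l<K. (if k = l then 0 else gram_sq w k l) + (if k = l then gram_sq w k l else 0))"
      by (intro sum.cong refl) auto
    also have "\<dots> = ?h + (\<Sum>k<K. gram_sq w k k)"
      by (simp add: sum.distrib)
    finally show ?thesis using h gram_sq_diagonal_bound[OF w, of K] by linarith
  qed
  then show ?thesis by blast
qed

text \<open>The variable \<open>X i\<close> is independent of the product of the other three, which
  may coincide among themselves, so the factor \<open>expectation (X i) = 0\<close> splits
  off.\<close>

lemma (in prob_space) expectation_prod4_eq_0:
  fixes X :: "'i \<Rightarrow> 'a \<Rightarrow> real"
  assumes ind: "indep_vars (\<lambda>_. borel) X UNIV"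
    and int4: "\<And>n. integrable M (\<lambda>x. X n x ^ 4)"
    and int1: "integrable M (X i)" and E0: "expectation (X i) = 0"
    and i: "i \<noteq> j" "i \<noteq> k" "i \<noteq> l"
  shows "expectation (\<lambda>x. X i x * (X j x * X k x * X l x)) = 0"
proof -
  have [measurable]: "X n \<in> borel_measurable M" for n
    using ind unfolding indep_vars_def2 by simp
  let ?A = "{i}" and ?B = "{j, k, l}"
  define p where "p f = (f i :: real)" for f :: "'i \<Rightarrow> real"
  define q where "q f = (f j * f k * f l :: real)" for f :: "'i \<Rightarrow> real"
  have r: "indep_var (PiM ?A (\<lambda>_. borel)) (\<lambda>x. restrict (\<lambda>n. X n x) ?A)
      (PiM ?B (\<lambda>_. borel)) (\<lambda>x. restrict (\<lambda>n. X n x) ?B)"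
    using i by (intro indep_var_restrict[OF ind]) auto
  have "p \<in> borel_measurable (PiM ?A (\<lambda>_. borel))"
    unfolding p_def by measurable
  moreover have "q \<in> borel_measurable (PiM ?B (\<lambda>_. borel))"
    unfolding q_def by (intro borel_measurable_times measurable_component_singleton) auto
  ultimately have "indep_var borel (p \<circ> (\<lambda>x. restrict (\<lambda>n. X n x) ?A)) borel (q \<circ> (\<lambda>x. restrict (\<lambda>n. X n x) ?B))"
    by (rule indep_var_compose[OF r])
  also have "p \<circ> (\<lambda>x. restrict (\<lambda>n. X n x) ?A) = X i"
    by (auto simp: p_def)
  also have "q \<circ> (\<lambda>x. restrict (\<lambda>n. X n x) ?B) = (\<lambda>x. X j x * X k x * X l x)"
    by (auto simp: q_def)
  finally have "indep_var borel (X i) borel (\<lambda>x. X j x * X k x * X l x)" .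
  moreover have "integrable M (\<lambda>x. X j x * X k x * X l x)"
  proof (rule Bochner_Integration.integrable_bound)
    show "integrable M (\<lambda>x. X j x ^ 4 + X k x ^ 4 + X l x ^ 4 + 1)"
      by (intro Bochner_Integration.integrable_add int4) auto
    show "AE x in M. norm (X j x * X k x * X l x) \<le> norm (X j x ^ 4 + X k x ^ 4 + X l x ^ 4 + 1)"
    proof (intro AE_I2)
      fix x
      show "norm (X j x * X k x * X l x) \<le> norm (X j x ^ 4 + X k x ^ 4 + X l x ^ 4 + 1)"
        \<comment> \<open>The constant 1 as fourth factor turns the estimate into one for three
          factors.\<close>
        using abs_prod4_le[of "X j x" "X k x" "X l x" 1] by simp
    qed
  qed measurable
  ultimately show ?thesis
    using indep_var_lebesgue_integral[of "X i" "\<lambda>x. X j x * X k x * X l x"] int1 E0 by simp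
qed

section \<open>Second moments of sums of pair products\<close>

context prob_space
begin

context
  fixes X :: "nat \<Rightarrow> 'a \<Rightarrow> real" and \<mu> :: real
  assumes ind: "indep_vars (\<lambda>_. borel) X UNIV"
    and int1: "\<And>n. integrable M (X n)" and E0: "\<And>n. expectation (X n) = 0"
    and int4: "\<And>n. integrable M (\<lambda>x. X n x ^ 4)" and E4: "\<And>n. expectation (\<lambda>x. X n x ^ 4) = \<mu>"
begin

lemma X_measurable [measurable]: "X n \<in> borel_measurable M"
  using ind unfolding indep_vars_def2 by simp

lemma integrable_prod4: "integrable M (\<lambda>x. (X i x * X j x) * (X k x * X l x))"
proof (rule Bochner_Integration.integrable_bound)
  show "integrable M (\<lambda>x. X i x ^ 4 + X j x ^ 4 + X k x ^ 4 + X l x ^ 4)"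
    by (intro Bochner_Integration.integrable_add int4)
  show "AE x in M. norm ((X i x * X j x) * (X k x * X l x)) \<le> norm (X i x ^ 4 + X j x ^ 4 + X k x ^ 4 + X l x ^ 4)"
  proof (intro AE_I2)
    fix x
    show "norm ((X i x * X j x) * (X k x * X l x)) \<le> norm (X i x ^ 4 + X j x ^ 4 + X k x ^ 4 + X l x ^ 4)"
      using abs_prod4_le[of "X i x" "X j x" "X k x" "X l x"] by (simp add: mult.assoc)
  qed
qed measurable

lemma expectation_pair_products:
  assumes "n \<noteq> m" "k \<noteq> l"
  shows "expectation (\<lambda>x. (X (n + k) x * X (n + l) x) * (X (m + k) x * X (m + l) x)) = 0"
proof -
  \<comment> \<open>The smallest of the four indices differs from the other three.\<close>
  note Z = expectation_prod4_eq_0[OF ind int4 int1 E0]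
  consider "n < m" "k < l" | "n < m" "l < k" | "m < n" "k < l" | "m < n" "l < k"
    using assms by linarith
  then show ?thesis
  proof cases
    case 1 then show ?thesis
      using Z[of "n + k" "n + l" "m + k" "m + l"] by (simp add: mult_ac)
  next
    case 2 then show ?thesis
      using Z[of "n + l" "n + k" "m + k" "m + l"] by (simp add: mult_ac)
  next
    case 3 then show ?thesis
      using Z[of "m + k" "n + l" "n + k" "m + l"] by (simp add: mult_ac)
  next
    case 4 then show ?thesis
      using Z[of "m + l" "n + l" "m + k" "n + k"] by (simp add: mult_ac)
  qed
qed

lemma fourth_moment_nonneg: "0 \<le> \<mu>"
  unfolding E4[of 0, symmetric] by (rule integral_nonneg_AE) auto

lemma expectation_square_product_le:
  "expectation (\<lambda>x. (X i x * X j x) * (X i x * X j x)) \<le> \<mu>"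
proof -
  have "expectation (\<lambda>x. (X i x * X j x) * (X i x * X j x)) \<le> expectation (\<lambda>x. (X i x ^ 4 + X j x ^ 4) / 2)"
  proof (rule integral_mono)
    fix x
    show "(X i x * X j x) * (X i x * X j x) \<le> (X i x ^ 4 + X j x ^ 4) / 2"
      using mult_le_mean_squares[of "(X i x)\<^sup>2" "(X j x)\<^sup>2"] by (simp add: power2_eq_square mult_ac power4_eq_xxxx)
  qed (intro integrable_prod4 integrable_divide Bochner_Integration.integrable_add int4)+
  also have "\<dots> = \<mu>" by (simp add: int4 E4)
  finally show ?thesis .
qed

lemma expectation_pair_sum:
  fixes d :: "nat \<Rightarrow> complex"
  assumes "k \<noteq> l"
  shows "integrable M (\<lambda>x. (cmod (\<Sum>n<N. d n * of_real (X (n + k) x * X (n + l) x)))\<^sup>2)"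
    and "expectation (\<lambda>x. (cmod (\<Sum>n<N. d n * of_real (X (n + k) x * X (n + l) x)))\<^sup>2)
      \<le> \<mu> * (\<Sum>n<N. (cmod (d n))\<^sup>2)"
proof -
  let ?Y = "\<lambda>n x. X (n + k) x * X (n + l) x"
  show "integrable M (\<lambda>x. (cmod (\<Sum>n<N. d n * of_real (?Y n x)))\<^sup>2)"
    unfolding norm_sum_of_real_square
    by (intro Bochner_Integration.integrable_sum integrable_mult_right integrable_prod4)
  have "expectation (\<lambda>x. (cmod (\<Sum>n<N. d n * of_real (?Y n x)))\<^sup>2)
      = (\<Sum>n<N. \<Sum>m<N. Re (d n * cnj (d m)) * expectation (\<lambda>x. ?Y n x * ?Y m x))"
    unfolding norm_sum_of_real_square
    by (simp only: Bochner_Integration.integral_sum Bochner_Integration.integrable_sum integrable_mult_right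
        integrable_prod4 integral_mult_right_zero)
  also have "\<dots> = (\<Sum>n<N. \<Sum>m<N. if m = n then Re (d n * cnj (d n)) * expectation (\<lambda>x. ?Y n x * ?Y n x) else 0)"
    using expectation_pair_products[OF _ assms] by (intro sum.cong refl) auto
  also have "\<dots> = (\<Sum>n<N. Re (d n * cnj (d n)) * expectation (\<lambda>x. ?Y n x * ?Y n x))"
    by simp
  also have "\<dots> \<le> (\<Sum>n<N. (cmod (d n))\<^sup>2 * \<mu>)"
  proof (intro sum_mono)
    fix n
    have "Re (d n * cnj (d n)) = (cmod (d n))\<^sup>2"
      by (simp add: complex_norm_square[symmetric] del: of_real_power)
    then show "Re (d n * cnj (d n)) * expectation (\<lambda>x. ?Y n x * ?Y n x) \<le> (cmod (d n))\<^sup>2 * \<mu>"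
      by (simp only: mult_left_mono expectation_square_product_le zero_le_power2)
  qed
  also have "\<dots> = \<mu> * (\<Sum>n<N. (cmod (d n))\<^sup>2)"
    by (simp add: sum_distrib_left mult.commute)
  finally show "expectation (\<lambda>x. (cmod (\<Sum>n<N. d n * of_real (?Y n x)))\<^sup>2) \<le> \<mu> * (\<Sum>n<N. (cmod (d n))\<^sup>2)" .
qed

section \<open>The Gram matrix of the random symbol\<close>

context
  fixes lam :: "nat \<Rightarrow> complex"
  assumes lam: "weighted_summable lam"
begin

abbreviation (input) "symbol x \<equiv> (\<lambda>n. complex_of_real (X n x) * cnj (lam n))"

lemma partial_gram_symbol:
  "partial_gram (symbol x) N k l
    = (\<Sum>n<N. (of_nat (Suc n) * (cnj (lam (n + k)) * lam (n + l))) * of_real (X (n + k) x * X (n + l) x))"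
  unfolding partial_gram_def by (intro sum.cong refl) (simp add: mult_ac)

text \<open>The bound does not depend on \<open>N\<close>, which is what Fatou's lemma
  needs.\<close>

lemma expectation_offdiag_gram_sum:
  "integrable M (\<lambda>x. offdiag_gram_sum (symbol x) N N)"
  "expectation (\<lambda>x. offdiag_gram_sum (symbol x) N N)
    \<le> \<mu> * ((\<Sum>n. real (Suc n) * (cmod (lam n))\<^sup>2)\<^sup>2 * (pi\<^sup>2 / 6))"
proof -
  let ?c = "\<lambda>n. real (Suc n) * (cmod (lam n))\<^sup>2"
  let ?g = "\<lambda>k l x. if k = l then 0 else (cmod (partial_gram (symbol x) N k l))\<^sup>2 / (real (Suc k) * real (Suc l))"
  have g: "integrable M (?g k l)" for k l
    using integrable_divide[OF expectation_pair_sum(1)] unfolding partial_gram_symbol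
    by (cases "k = l") simp_all
  then show "integrable M (\<lambda>x. offdiag_gram_sum (symbol x) N N)"
    unfolding offdiag_gram_sum_def by (intro Bochner_Integration.integrable_sum)
  have E: "expectation (?g k l) \<le> (\<Sum>n<N. \<mu> * (?c (n + k) * ?c (n + l) / (real (Suc k) * real (Suc l))))" for k l
  proof (cases "k = l")
    case True
    then show ?thesis by (auto intro!: sum_nonneg mult_nonneg_nonneg fourth_moment_nonneg divide_nonneg_nonneg)
  next
    case False
    have "expectation (?g k l) \<le> \<mu> * (\<Sum>n<N. (cmod (of_nat (Suc n) * (cnj (lam (n + k)) * lam (n + l))))\<^sup>2) / (real (Suc k) * real (Suc l))"
      using False unfolding partial_gram_symbol
      by (auto simp del: of_nat_Suc of_real_mult intro!: divide_right_mono expectation_pair_sum(2))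
    also have "\<dots> \<le> \<mu> * (\<Sum>n<N. ?c (n + k) * ?c (n + l)) / (real (Suc k) * real (Suc l))"
    proof (intro divide_right_mono mult_left_mono sum_mono fourth_moment_nonneg)
      fix n
      have "(cmod (of_nat (Suc n) * (cnj (lam (n + k)) * lam (n + l))))\<^sup>2
         = (real (Suc n) * (cmod (lam (n + k)))\<^sup>2) * (real (Suc n) * (cmod (lam (n + l)))\<^sup>2)"
        by (simp add: norm_mult power2_eq_square mult_ac del: of_nat_Suc)
      \<comment> \<open>The squared weight \<open>(n + 1)^2\<close> is shared between the two
        factors, each of which has a larger index.\<close>
      also have "\<dots> \<le> ?c (n + k) * ?c (n + l)"
        by (intro mult_mono mult_right_mono) auto
      finally show "(cmod (of_nat (Suc n) * (cnj (lam (n + k)) * lam (n + l))))\<^sup>2 \<le> ?c (n + k) * ?c (n + l)" .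
    qed auto
    finally show ?thesis by (simp only: sum_distrib_left sum_divide_distrib times_divide_eq_right)
  qed
  have "expectation (\<lambda>x. offdiag_gram_sum (symbol x) N N) = (\<Sum>k<N. \<Sum>l<N. expectation (?g k l))"
    unfolding offdiag_gram_sum_def
    by (simp only: Bochner_Integration.integral_sum Bochner_Integration.integrable_sum g)
  also have "\<dots> \<le> (\<Sum>k<N. \<Sum>l<N. \<Sum>n<N. \<mu> * (?c (n + k) * ?c (n + l) / (real (Suc k) * real (Suc l))))"
    by (intro sum_mono E)
  also have "\<dots> = \<mu> * (\<Sum>k<N. \<Sum>l<N. \<Sum>n<N. ?c (n + k) * ?c (n + l) / (real (Suc k) * real (Suc l)))"
    by (simp only: sum_distrib_left)
  also have "\<dots> \<le> \<mu> * ((suminf ?c)\<^sup>2 * (\<Sum>k<N. 1 / (real (Suc k))\<^sup>2))"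
    by (intro mult_left_mono fourth_moment_nonneg convolution_square_sum_bound lam) auto
  also have "\<dots> \<le> \<mu> * ((suminf ?c)\<^sup>2 * (pi\<^sup>2 / 6))"
    by (intro mult_left_mono fourth_moment_nonneg inverse_squares_partial_sum) auto
  finally show "expectation (\<lambda>x. offdiag_gram_sum (symbol x) N N) \<le> \<mu> * ((suminf ?c)\<^sup>2 * (pi\<^sup>2 / 6))" .
qed

text \<open>By Fatou's lemma the \<open>liminf\<close> has finite expectation, hence it is finite
  almost surely.\<close>

lemma AE_liminf_offdiag_finite:
  "AE x in M. liminf (\<lambda>N. ennreal (offdiag_gram_sum (symbol x) N N)) \<noteq> \<infinity>"
proof (rule nn_integral_PInf_AE)
  let ?B = "\<mu> * ((\<Sum>n. real (Suc n) * (cmod (lam n))\<^sup>2)\<^sup>2 * (pi\<^sup>2 / 6))"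
  have nn: "0 \<le> offdiag_gram_sum w N K" for w N K
    unfolding offdiag_gram_sum_def by (intro sum_nonneg) auto
  have m[measurable]: "(\<lambda>x. offdiag_gram_sum (symbol x) N N) \<in> borel_measurable M" for N
    by (rule borel_measurable_integrable[OF expectation_offdiag_gram_sum(1)])
  show "(\<lambda>x. liminf (\<lambda>N. ennreal (offdiag_gram_sum (symbol x) N N))) \<in> borel_measurable M"
    by measurable
  have "(\<integral>\<^sup>+x. liminf (\<lambda>N. ennreal (offdiag_gram_sum (symbol x) N N)) \<partial>M)
      \<le> liminf (\<lambda>N. \<integral>\<^sup>+x. ennreal (offdiag_gram_sum (symbol x) N N) \<partial>M)"
    by (rule nn_integral_liminf) measurable
  also have "\<dots> \<le> ennreal ?B"
  proof (rule order_trans[OF Liminf_mono])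
    show "\<forall>\<^sub>F N in sequentially. (\<integral>\<^sup>+x. ennreal (offdiag_gram_sum (symbol x) N N) \<partial>M) \<le> ennreal ?B"
      using expectation_offdiag_gram_sum nn
      by (intro always_eventually allI) (subst nn_integral_eq_integral, auto intro!: ennreal_leI)
  qed (simp add: Liminf_const)
  also have "\<dots> < \<infinity>" by simp
  finally show "(\<integral>\<^sup>+x. liminf (\<lambda>N. ennreal (offdiag_gram_sum (symbol x) N N)) \<partial>M) \<noteq> \<infinity>"
    by simp
qed

text \<open>Since \<open>X^2 \<le> 1 + X^4\<close>, the second moments are at most
  \<open>1 + \<mu>\<close>, so the nonnegative weighted series has finite expectation and converges
  almost surely.\<close>

lemma AE_symbol_weighted_summable: "AE x in M. weighted_summable (symbol x)"
proof -
  let ?c = "\<lambda>n. real (Suc n) * (cmod (lam n))\<^sup>2"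
  have X2: "(X n x)\<^sup>2 \<le> 1 + X n x ^ 4" for n x
  proof -
    have "2 * (X n x)\<^sup>2 \<le> 1 + X n x ^ 4"
      using mult_le_mean_squares[of 1 "(X n x)\<^sup>2"] by simp
    then show ?thesis using zero_le_power2[of "X n x"] by linarith
  qed
  have E2: "(\<integral>\<^sup>+x. ennreal (?c n * (X n x)\<^sup>2) \<partial>M) \<le> ennreal (?c n * (1 + \<mu>))" for n
  proof -
    have "(\<integral>\<^sup>+x. ennreal (?c n * (X n x)\<^sup>2) \<partial>M) \<le> (\<integral>\<^sup>+x. ennreal (?c n * (1 + X n x ^ 4)) \<partial>M)"
      by (intro nn_integral_mono ennreal_leI mult_left_mono X2) auto
    also have "\<dots> = ennreal (expectation (\<lambda>x. ?c n * (1 + X n x ^ 4)))"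
      by (intro nn_integral_eq_integral) (auto intro!: int4 mult_nonneg_nonneg add_nonneg_nonneg)
    also have "expectation (\<lambda>x. ?c n * (1 + X n x ^ 4)) = ?c n * (1 + \<mu>)"
      by (simp add: int4 E4 prob_space del: of_nat_Suc)
    finally show ?thesis .
  qed
  have "AE x in M. (\<Sum>n. ennreal (?c n * (X n x)\<^sup>2)) \<noteq> \<infinity>"
  proof (rule nn_integral_PInf_AE)
    show "(\<lambda>x. \<Sum>n. ennreal (?c n * (X n x)\<^sup>2)) \<in> borel_measurable M" by measurable
    have "(\<integral>\<^sup>+x. (\<Sum>n. ennreal (?c n * (X n x)\<^sup>2)) \<partial>M) = (\<Sum>n. \<integral>\<^sup>+x. ennreal (?c n * (X n x)\<^sup>2) \<partial>M)"
      by (rule nn_integral_suminf) measurable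
    also have "\<dots> \<le> (\<Sum>n. ennreal (?c n * (1 + \<mu>)))"
      by (intro suminf_le E2) auto
    also have "\<dots> = ennreal (\<Sum>n. ?c n * (1 + \<mu>))"
      using fourth_moment_nonneg by (intro suminf_ennreal2 summable_mult2 lam) auto
    also have "\<dots> < \<infinity>" by simp
    finally show "(\<integral>\<^sup>+x. (\<Sum>n. ennreal (?c n * (X n x)\<^sup>2)) \<partial>M) \<noteq> \<infinity>" by simp
  qed
  then show ?thesis
  proof eventually_elim
    case (elim x)
    have "summable (\<lambda>n. ?c n * (X n x)\<^sup>2)"
      by (rule summable_suminf_not_top) (use elim in \<open>simp_all del: of_nat_Suc\<close>)
    then show ?case
      by (simp add: norm_mult power_mult_distrib mult_ac del: of_nat_Suc)
  qed
qed

theorem AE_hankel_compact: "AE x in M. hankel_compact_on_dirichlet (symbol x)"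
  using AE_liminf_offdiag_finite AE_symbol_weighted_summable
proof eventually_elim
  case (elim x)
  from gram_sq_sum_bounded[OF elim(2,1)] obtain L
    where "\<And>K. (\<Sum>k<K. \<Sum>l<K. gram_sq (symbol x) k l) \<le> L" by blast
  with elim(2) show ?case by (rule hankel_compact_if_gram_bounded)
qed

end
end
end

theorem theorem1p4:
  fixes lam :: "nat \<Rightarrow> complex"
    and M :: "'a measure"
    and X :: "nat \<Rightarrow> 'a \<Rightarrow> real"
  assumes "prob_space M"
    and "prob_space.indep_vars M (\<lambda>_. borel) X UNIV"
    and "\<And>n. distr M borel (X n) = distr M borel (X 0)"
    and "\<And>n. integrable M (X n)"
    and "\<And>n. prob_space.expectation M (X n) = 0"
    and "\<And>n. integrable M (\<lambda>x. X n x ^ 4)"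
    and "converges_on_disk lam"
    and "power_series_fun lam \<in> dirichlet_space"
  shows "AE x in M. hankel_compact_on_dirichlet (\<lambda>n. of_real (X n x) * cnj (lam n))"
proof -
  interpret prob_space M by fact
  \<comment> \<open>Convergence on the disk identifies \<open>lam\<close> with the Taylor
    coefficients, so membership in the Dirichlet space becomes a condition on
    \<open>lam\<close>.\<close>
  have "(\<lambda>n. lam n * z ^ n) sums power_series_fun lam z" if "z \<in> \<bbbD>" for z
    using assms(7) that by (auto simp: converges_on_disk_def power_series_fun_def summable_sums)
  then have "taylor_coeff (power_series_fun lam) = lam"
    by (rule taylor_coeff_unique)
  then have lam: "weighted_summable lam"
    using dirichlet_space_weighted_sum(1)[OF assms(8)] by simp
  have m: "X n \<in> borel_measurable M" for n
    using assms(2) unfolding indep_vars_def2 by simp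
  \<comment> \<open>Equality of the laws makes the fourth moments a common constant, which plays the
    role of \<open>\<mu>\<close>.\<close>
  have "expectation (\<lambda>x. X n x ^ 4) = expectation (\<lambda>x. X 0 x ^ 4)" for n
  proof -
    have "expectation (\<lambda>x. X k x ^ 4) = integral\<^sup>L (distr M borel (X k)) (\<lambda>y. y ^ 4)" for k
      by (rule integral_distr[symmetric]) (use m in auto)
    then show ?thesis using assms(3)[of n] by simp
  qed
  from AE_hankel_compact[OF assms(2,4,5,6) this lam] show ?thesis .
qed

end
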